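(* Let $2\le p<\infty$ and $1/p+1/q=1$. Let $p_{m,k}^H\in V_m^H\subset V^{H\times h}$ be the reduced solution, let $\beta_p,\gamma_p,L_p$ be the inf-sup, continuity and Lipschitz constants at $p_{m,k}^H$ defined in the context, and set $$\tau_{m,p}^k:=\frac{2L_p}{\beta_p^2}\Big(\|F(p_{m,k}^H)-P_k^L[F(p_{m,k}^H)]\|_{W^{-1,p}(\Omega)}+\|P_k^L[F(p_{m,k}^H)]\|_{W^{-1,p}(\Omega)}\Big),\qquad \Delta_{m,p}^k:=\frac{\beta_p}{L_p}\Big(1-\sqrt{1-\tau_{m,p}^k}\Big).$$ Assume that $$\|F(p_{m,k}^H)-P_k^L[F(p_{m,k}^H)]\|_{W^{-1,p}(\Omega)}\le c_{\mathrm{err}}\|P_k^L[F(p_{m,k}^H)]\|_{W^{-1,p}(\Omega)}$$ for some $c_{\mathrm{err}}\in[0,1)$, and set $C_{\mathrm{err}}:=\frac{1-c_{\mathrm{err}}}{1+c_{\mathrm{err}}}$. If $\tau_{m,p}^k\le\frac12C_{\mathrm{err}}$, then $$\Delta_{m,p}^k\le4\,C_{\mathrm{err}}^{-1}\,\frac{\gamma_p}{\beta_p}\,|p^{H\times h}-p_{m,k}^H|_{W^{1,p}(\Omega)},$$ where $p^{H\times h}$ is the unique element of $B(p_{m,k}^H,\beta_p/L_p)$ with $\langle F(p^{H\times h}),v^{H\times h}\rangle=0$ for all $v^{H\times h}\in V^{H\times h}$.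
   Context: Domain and problem. $\Omega=\Omega_{1D}\times\omega\subset\mathbb R^2$, $\Omega_{1D}=(x_0,x_1)$, $\omega=(y_0,y_1)$. $A$ is a nonlinear elliptic operator, $f$ a given right-hand side, $\langle F(w),v\rangle=\langle A(w),v\rangle-\langle f,v\rangle$, where $F$ is regarded as a continuously Fréchet differentiable mapping from $W^{1,p}_0(\Omega)$ to $W^{-1,p}(\Omega)=(W_0^{1,q}(\Omega))'$ with derivative $F'$. Discrete spaces. $V^{H\times h}$ is the tensor-product finite element space of continuous functions on $\Omega$, vanishing on $\partial\Omega$, that are on every rectangle of the product $\mathcal T_H\times\tau_h$ of a partition of $\Omega_{1D}$ and a partition of $\omega$ polynomials of degree at most $r$ in $x$ and at most $s$ in $y$. $X^H\subset H_0^1(\Omega_{1D})$ and $Y^h\subset H^1_0(\omega)$ are the corresponding one-dimensional conforming finite element spaces; $\phi_1,\dots,\phi_m\in Y^h$ are $L^2(\omega)$-orthonormal, and $V_m^H=\{\sum_{s=1}^m\bar v_s(x)\phi_s(y):\bar v_s\in X^H\}\subset V^{H\times h}$. Operator approximation and reduced solution. $\kappa_1,\dots,\kappa_k$ are $L^2(\omega)$-orthonormal (collateral basis) functions, $\mathfrak I$ a partition of $\omega$ into intervals, and for each $I\in\mathfrak I$, $\sigma_j^I$ ($1\le j\le k_I$) are linear functionals on functions on $I$ and $\vartheta_j^I\in\mathrm{span}\{\kappa_1|_I,\dots,\kappa_k|_I\}$ (extended by zero) satisfy $\sigma_i^I(\vartheta_j^I)=\delta_{ij}$. With $L=\sum_Ik_I$,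 the empirical projection of $A(w)$ is $$P_k^L[A(w)](x,y)=\sum_{n=1}^k\sum_{I\in\mathfrak I}\sum_{j=1}^{k_I}\sigma_j^I(A(w)(x,\cdot))\int_\omega\vartheta_j^I(z)\kappa_n(z)\,dz\;\kappa_n(y)$$ (applied component-wise to $u_1,u_2$ when $\langle A(w),v\rangle=\int_\Omega u_1\partial_xv+u_2\partial_yv$), and $P_k^L[F(w)]$ is the functional $\langle P_k^L[F(w)],v\rangle=\langle P_k^L[A(w)],v\rangle-\langle f,v\rangle$. The reduced solution $p_{m,k}^H\in V_m^H$ satisfies $\langle P_k^L[F(p_{m,k}^H)],v\rangle=0$ for all $v\in V_m^H$. Norms and constants. $|\cdot|_{W^{1,p}(\Omega)}$ is the $W^{1,p}$-seminorm; dual norms and operator norms are taken with respect to the finite dimensional space: $\|G\|_{W^{-1,p}(\Omega)}=\sup_{0\ne v\in V^{H\times h}}\langle G,v\rangle/|v|_{W^{1,q}(\Omega)}$ and $\|T\|_{W^{1,p}(\Omega),W^{-1,p}(\Omega)}=\sup_{0\ne w\in V^{H\times h}}\|Tw\|_{W^{-1,p}(\Omega)}/|w|_{W^{1,p}(\Omega)}$. $B(p_{m,k}^H,R)=\{w\in V^{H\times h}:|w-p_{m,k}^H|_{W^{1,p}(\Omega)}\le R\}$. $$\beta_p=\inf_{0\ne w\in V^{H\times h}}\sup_{0\ne v\in V^{H\times h}}\frac{\langle F'(p_{m,k}^H)w,v\rangle}{|w|_{W^{1,p}(\Omega)}|v|_{W^{1,q}(\Omega)}},\qquad \gamma_p=\sup_{0\ne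 w\in V^{H\times h}}\sup_{0\ne v\in V^{H\times h}}\frac{\langle F'(p_{m,k}^H)w,v\rangle}{|w|_{W^{1,p}(\Omega)}|v|_{W^{1,q}(\Omega)}},$$ $$L_p=\sup_{w\in B(p_{m,k}^H,R),\,w\ne p_{m,k}^H}\frac{\|F'(w)-F'(p_{m,k}^H)\|_{W^{1,p}(\Omega),W^{-1,p}(\Omega)}}{|w-p_{m,k}^H|_{W^{1,p}(\Omega)}}.$$ It is assumed that $\beta_p>0$, $0<L_p<\infty$, and that $R>0$ is such that $R\ge\beta_p/L_p$. (When $\tau_{m,p}^k<1$, the solution $p^{H\times h}$ in $B(p_{m,k}^H,\beta_p/L_p)$ exists and is unique.) *)

theory Defs
  imports
    "HOL-Analysis.Analysis"
    "HOL-Library.Function_Algebras"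
    "HOL-Library.Disjoint_Sets"
begin

type_synonym plane_fun = "real \<times> real \<Rightarrow> real"

text \<open>
  Elements of Lebesgue and Sobolev spaces are represented by functions on the whole plane;
  only their values on the domain, up to null sets, are relevant.
\<close>

definition Lp_space :: "(real \<times> real) set \<Rightarrow> real \<Rightarrow> plane_fun set" where
  "Lp_space \<Omega> p =
     {g. set_borel_measurable lborel \<Omega> g \<and> set_integrable lborel \<Omega> (\<lambda>z. \<bar>g z\<bar> powr p)}"

text \<open>\<open>D i j\<close> plays the role of the mixed partial derivative of order \<open>(i, j)\<close>.\<close>

definition smooth_fun :: "plane_fun \<Rightarrow> bool" where
  "smooth_fun \<phi> \<longleftrightarrow>
     (\<exists>D :: nat \<Rightarrow> nat \<Rightarrow> plane_fun. D 0 0 = \<phi> \<and>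
        (\<forall>i j z. (D i j has_derivative (\<lambda>(a, b). a * D (Suc i) j z + b * D i (Suc j) z)) (at z)))"

definition test_funs :: "(real \<times> real) set \<Rightarrow> plane_fun set" where
  "test_funs \<Omega> =
     {\<phi>. smooth_fun \<phi> \<and> (\<exists>K. compact K \<and> K \<subseteq> \<Omega> \<and> (\<forall>z. z \<notin> K \<longrightarrow> \<phi> z = 0))}"

definition has_weak_deriv ::
  "(real \<times> real) set \<Rightarrow> real \<times> real \<Rightarrow> plane_fun \<Rightarrow> plane_fun \<Rightarrow> bool" where
  "has_weak_deriv \<Omega> e v g \<longleftrightarrow>
     (\<forall>K. compact K \<and> K \<subseteq> \<Omega> \<longrightarrow> set_integrable lborel K v \<and> set_integrable lborel K g) \<and>
     (\<forall>\<phi>\<in>test_funs \<Omega>.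
        (LINT z:\<Omega>|lborel. v z * frechet_derivative \<phi> (at z) e) = - (LINT z:\<Omega>|lborel. g z * \<phi> z))"

text \<open>A representative of the weak derivative, which is unique up to null sets in open \<open>\<Omega>\<close>.\<close>

definition weak_deriv :: "(real \<times> real) set \<Rightarrow> real \<times> real \<Rightarrow> plane_fun \<Rightarrow> plane_fun" where
  "weak_deriv \<Omega> e v = (SOME g. has_weak_deriv \<Omega> e v g)"

definition W1 :: "(real \<times> real) set \<Rightarrow> real \<Rightarrow> plane_fun set" where
  "W1 \<Omega> p =
     {v \<in> Lp_space \<Omega> p. \<forall>e\<in>Basis. \<exists>g\<in>Lp_space \<Omega> p. has_weak_deriv \<Omega> e v g}"

definition W1_seminorm :: "(real \<times> real) set \<Rightarrow> real \<Rightarrow> plane_fun \<Rightarrow> real" where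
  "W1_seminorm \<Omega> p v =
     (\<Sum>e\<in>Basis. LINT z:\<Omega>|lborel. \<bar>weak_deriv \<Omega> e v z\<bar> powr p) powr (1 / p)"

definition W1_norm :: "(real \<times> real) set \<Rightarrow> real \<Rightarrow> plane_fun \<Rightarrow> real" where
  "W1_norm \<Omega> p v =
     ((LINT z:\<Omega>|lborel. \<bar>v z\<bar> powr p) +
      (\<Sum>e\<in>Basis. LINT z:\<Omega>|lborel. \<bar>weak_deriv \<Omega> e v z\<bar> powr p)) powr (1 / p)"

definition W1_zero :: "(real \<times> real) set \<Rightarrow> real \<Rightarrow> plane_fun set" where
  "W1_zero \<Omega> p =
     {v \<in> W1 \<Omega> p. \<exists>\<phi>. (\<forall>n. \<phi> n \<in> test_funs \<Omega>) \<and> (\<lambda>n. W1_norm \<Omega> p (\<phi> n - v)) \<longlonglongrightarrow> 0}"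

text \<open>
  The dual of \<open>W1_zero \<Omega> q\<close>. On bounded domains the seminorm is a norm on this space, equivalent
  to the full norm by Poincare's inequality, and it is the norm used for \<open>W1_zero\<close> below.
\<close>

definition dual_W1_zero :: "(real \<times> real) set \<Rightarrow> real \<Rightarrow> (plane_fun \<Rightarrow> real) set" where
  "dual_W1_zero \<Omega> q =
     {G. (\<forall>v\<in>W1_zero \<Omega> q. \<forall>w\<in>W1_zero \<Omega> q. \<forall>a b.
            G (\<lambda>z. a * v z + b * w z) = a * G v + b * G w) \<and>
         (\<exists>C. \<forall>v\<in>W1_zero \<Omega> q. \<bar>G v\<bar> \<le> C * W1_seminorm \<Omega> q v)}"

text \<open>
  \<open>F\<close> maps \<open>W1_zero \<Omega> p\<close> into the dual of \<open>W1_zero \<Omega> q\<close> and is continuously Frechet differentiable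
  there, with derivative \<open>F'\<close>. A bound by \<open>\<epsilon> * \<bar>v\<bar>\<close> for all \<open>v\<close> says that the dual norm
  is at most \<open>\<epsilon>\<close>.
\<close>

definition C1_frechet ::
  "(real \<times> real) set \<Rightarrow> real \<Rightarrow> real \<Rightarrow> (plane_fun \<Rightarrow> plane_fun \<Rightarrow> real) \<Rightarrow>
   (plane_fun \<Rightarrow> plane_fun \<Rightarrow> plane_fun \<Rightarrow> real) \<Rightarrow> bool" where
  "C1_frechet \<Omega> p q F F' \<longleftrightarrow>
     (\<forall>w\<in>W1_zero \<Omega> p. F w \<in> dual_W1_zero \<Omega> q) \<and>
     (\<forall>w\<in>W1_zero \<Omega> p. \<forall>h\<in>W1_zero \<Omega> p. F' w h \<in> dual_W1_zero \<Omega> q) \<and>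
     (\<forall>w\<in>W1_zero \<Omega> p. \<forall>g\<in>W1_zero \<Omega> p. \<forall>h\<in>W1_zero \<Omega> p. \<forall>a b. \<forall>v\<in>W1_zero \<Omega> q.
        F' w (\<lambda>z. a * g z + b * h z) v = a * F' w g v + b * F' w h v) \<and>
     (\<forall>w\<in>W1_zero \<Omega> p. \<exists>C. \<forall>h\<in>W1_zero \<Omega> p. \<forall>v\<in>W1_zero \<Omega> q.
        \<bar>F' w h v\<bar> \<le> C * W1_seminorm \<Omega> p h * W1_seminorm \<Omega> q v) \<and>
     (\<forall>w\<in>W1_zero \<Omega> p. \<forall>\<epsilon>>0. \<exists>\<delta>>0. \<forall>h\<in>W1_zero \<Omega> p. W1_seminorm \<Omega> p h < \<delta> \<longrightarrow>
        (\<forall>v\<in>W1_zero \<Omega> q. \<bar>F (w + h) v - F w v - F' w h v\<bar>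
            \<le> \<epsilon> * W1_seminorm \<Omega> p h * W1_seminorm \<Omega> q v)) \<and>
     (\<forall>w\<in>W1_zero \<Omega> p. \<forall>\<epsilon>>0. \<exists>\<delta>>0. \<forall>w'\<in>W1_zero \<Omega> p. W1_seminorm \<Omega> p (w' - w) < \<delta> \<longrightarrow>
        (\<forall>h\<in>W1_zero \<Omega> p. \<forall>v\<in>W1_zero \<Omega> q. \<bar>F' w' h v - F' w h v\<bar>
            \<le> \<epsilon> * W1_seminorm \<Omega> p h * W1_seminorm \<Omega> q v))"

text \<open>The interval \<open>(a, b)\<close> is partitioned by \<open>a = \<xi> 0 < \<xi> 1 < \<dots> < \<xi> N = b\<close>.\<close>

definition interval_nodes :: "real \<Rightarrow> real \<Rightarrow> nat \<Rightarrow> (nat \<Rightarrow> real) \<Rightarrow> bool" where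
  "interval_nodes a b N \<xi> \<longleftrightarrow> \<xi> 0 = a \<and> \<xi> N = b \<and> (\<forall>i<N. \<xi> i < \<xi> (Suc i))"

text \<open>
  Finite element functions are extended by zero outside the domain; continuity on the whole
  space then encodes the vanishing boundary values.
\<close>

definition fe_space_1d :: "nat \<Rightarrow> (nat \<Rightarrow> real) \<Rightarrow> nat \<Rightarrow> (real \<Rightarrow> real) set" where
  "fe_space_1d N \<xi> r =
     {v. continuous_on UNIV v \<and> (\<forall>x. x \<notin> {\<xi> 0<..<\<xi> N} \<longrightarrow> v x = 0) \<and>
         (\<forall>i<N. \<exists>c :: nat \<Rightarrow> real. \<forall>x\<in>{\<xi> i..\<xi> (Suc i)}. v x = (\<Sum>a\<le>r. c a * x ^ a))}"

definition fe_space_2d ::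
  "nat \<Rightarrow> (nat \<Rightarrow> real) \<Rightarrow> nat \<Rightarrow> nat \<Rightarrow> (nat \<Rightarrow> real) \<Rightarrow> nat \<Rightarrow> plane_fun set" where
  "fe_space_2d N \<xi> r M \<eta> s =
     {v. continuous_on UNIV v \<and>
         (\<forall>z. z \<notin> {\<xi> 0<..<\<xi> N} \<times> {\<eta> 0<..<\<eta> M} \<longrightarrow> v z = 0) \<and>
         (\<forall>i<N. \<forall>j<M. \<exists>c :: nat \<Rightarrow> nat \<Rightarrow> real.
            \<forall>x\<in>{\<xi> i..\<xi> (Suc i)}. \<forall>y\<in>{\<eta> j..\<eta> (Suc j)}.
              v (x, y) = (\<Sum>a\<le>r. \<Sum>b\<le>s. c a b * x ^ a * y ^ b))}"

definition reduced_space ::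
  "(real \<Rightarrow> real) set \<Rightarrow> nat \<Rightarrow> (nat \<Rightarrow> real \<Rightarrow> real) \<Rightarrow> plane_fun set" where
  "reduced_space X m \<phi> =
     {\<lambda>(x, y). \<Sum>l=1..m. vbar l x * \<phi> l y | vbar. \<forall>l\<in>{1..m}. vbar l \<in> X}"

definition L2_orthonormal :: "real set \<Rightarrow> nat \<Rightarrow> (nat \<Rightarrow> real \<Rightarrow> real) \<Rightarrow> bool" where
  "L2_orthonormal \<omega> n \<phi> \<longleftrightarrow>
     (\<forall>i\<in>{1..n}. set_borel_measurable lborel \<omega> (\<phi> i) \<and> set_integrable lborel \<omega> (\<lambda>y. (\<phi> i y)\<^sup>2)) \<and>
     (\<forall>i\<in>{1..n}. \<forall>j\<in>{1..n}. (LINT y:\<omega>|lborel. \<phi> i y * \<phi> j y) = (if i = j then 1 else 0))"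

text \<open>
  The values of the operator \<open>A\<close> are given by component functions \<open>u 0, u 1, u 2\<close>, acting as
  \<open>v \<mapsto> \<integral> u 0 * v + u 1 * \<partial>\<^sub>x v + u 2 * \<partial>\<^sub>y v\<close>. This comprises operators whose values are functions
  (\<open>u 1 = u 2 = 0\<close>) as well as operators in divergence form (\<open>u 0 = 0\<close>).
\<close>

definition test_comp :: "(real \<times> real) set \<Rightarrow> nat \<Rightarrow> plane_fun \<Rightarrow> plane_fun" where
  "test_comp \<Omega> i v =
     (if i = 0 then v else if i = 1 then weak_deriv \<Omega> (1, 0) v else weak_deriv \<Omega> (0, 1) v)"

definition comp_pairing :: "(real \<times> real) set \<Rightarrow> (nat \<Rightarrow> plane_fun) \<Rightarrow> plane_fun \<Rightarrow> real" where
  "comp_pairing \<Omega> u v = (\<Sum>i\<le>2. LINT z:\<Omega>|lborel. u i z * test_comp \<Omega> i v z)"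

definition residual ::
  "(real \<times> real) set \<Rightarrow> (plane_fun \<Rightarrow> nat \<Rightarrow> plane_fun) \<Rightarrow> (plane_fun \<Rightarrow> real) \<Rightarrow>
   plane_fun \<Rightarrow> plane_fun \<Rightarrow> real" where
  "residual \<Omega> A f w v = comp_pairing \<Omega> (A w) v - f v"

text \<open>
  \<open>\<sigma> I j\<close> is a linear functional on functions on the interval \<open>I\<close>: it is linear and only sees the
  values on \<open>I\<close>. A functional given only on a subspace (e.g. a moment) may be extended linearly.
\<close>

definition linear_functional_on :: "real set \<Rightarrow> ((real \<Rightarrow> real) \<Rightarrow> real) \<Rightarrow> bool" where
  "linear_functional_on I s \<longleftrightarrow>
     (\<forall>g h. (\<forall>z\<in>I. g z = h z) \<longrightarrow> s g = s h) \<and>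
     (\<forall>g h a b. s (\<lambda>z. a * g z + b * h z) = a * s g + b * s h)"

definition empirical_system ::
  "real set \<Rightarrow> nat \<Rightarrow> (nat \<Rightarrow> real \<Rightarrow> real) \<Rightarrow> real set set \<Rightarrow> (real set \<Rightarrow> nat) \<Rightarrow>
   (real set \<Rightarrow> nat \<Rightarrow> (real \<Rightarrow> real) \<Rightarrow> real) \<Rightarrow> (real set \<Rightarrow> nat \<Rightarrow> real \<Rightarrow> real) \<Rightarrow> bool" where
  "empirical_system \<omega> k \<kappa> \<II> kI \<sigma> \<theta> \<longleftrightarrow>
     L2_orthonormal \<omega> k \<kappa> \<and>
     finite \<II> \<and> partition_on \<omega> \<II> \<and> (\<forall>I\<in>\<II>. is_interval I) \<and>
     (\<forall>I\<in>\<II>. \<forall>j\<in>{1..kI I}. linear_functional_on I (\<sigma> I j)) \<and>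
     (\<forall>I\<in>\<II>. \<forall>j\<in>{1..kI I}. \<exists>c :: nat \<Rightarrow> real.
        \<theta> I j = (\<lambda>y. if y \<in> I then \<Sum>n=1..k. c n * \<kappa> n y else 0)) \<and>
     (\<forall>I\<in>\<II>. \<forall>i\<in>{1..kI I}. \<forall>j\<in>{1..kI I}. \<sigma> I i (\<theta> I j) = (if i = j then 1 else 0))"

definition emp_proj ::
  "real set \<Rightarrow> nat \<Rightarrow> (nat \<Rightarrow> real \<Rightarrow> real) \<Rightarrow> real set set \<Rightarrow> (real set \<Rightarrow> nat) \<Rightarrow>
   (real set \<Rightarrow> nat \<Rightarrow> (real \<Rightarrow> real) \<Rightarrow> real) \<Rightarrow> (real set \<Rightarrow> nat \<Rightarrow> real \<Rightarrow> real) \<Rightarrow>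
   plane_fun \<Rightarrow> plane_fun" where
  "emp_proj \<omega> k \<kappa> \<II> kI \<sigma> \<theta> g = (\<lambda>(x, y).
     \<Sum>n=1..k. \<Sum>I\<in>\<II>. \<Sum>j=1..kI I.
       \<sigma> I j (\<lambda>z. g (x, z)) * (LINT z:\<omega>|lborel. \<theta> I j z * \<kappa> n z) * \<kappa> n y)"

text \<open>
  Suprema and infima are taken in the extended reals, so that they always exist.
\<close>

definition dual_norm ::
  "(real \<times> real) set \<Rightarrow> real \<Rightarrow> plane_fun set \<Rightarrow> (plane_fun \<Rightarrow> real) \<Rightarrow> ereal" where
  "dual_norm \<Omega> q V G = (SUP v\<in>V - {0}. ereal (G v / W1_seminorm \<Omega> q v))"

definition op_norm ::
  "(real \<times> real) set \<Rightarrow> real \<Rightarrow> real \<Rightarrow> plane_fun set \<Rightarrow> (plane_fun \<Rightarrow> plane_fun \<Rightarrow> real) \<Rightarrow>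
   ereal" where
  "op_norm \<Omega> p q V T = (SUP w\<in>V - {0}. dual_norm \<Omega> q V (T w) / ereal (W1_seminorm \<Omega> p w))"

definition fe_ball ::
  "(real \<times> real) set \<Rightarrow> real \<Rightarrow> plane_fun set \<Rightarrow> plane_fun \<Rightarrow> ereal \<Rightarrow> plane_fun set" where
  "fe_ball \<Omega> p V c \<rho> = {w \<in> V. ereal (W1_seminorm \<Omega> p (w - c)) \<le> \<rho>}"

definition infsup_const ::
  "(real \<times> real) set \<Rightarrow> real \<Rightarrow> real \<Rightarrow> plane_fun set \<Rightarrow> (plane_fun \<Rightarrow> plane_fun \<Rightarrow> real) \<Rightarrow>
   ereal" where
  "infsup_const \<Omega> p q V T =
     (INF w\<in>V - {0}. SUP v\<in>V - {0}. ereal (T w v / (W1_seminorm \<Omega> p w * W1_seminorm \<Omega> q v)))"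

definition continuity_const ::
  "(real \<times> real) set \<Rightarrow> real \<Rightarrow> real \<Rightarrow> plane_fun set \<Rightarrow> (plane_fun \<Rightarrow> plane_fun \<Rightarrow> real) \<Rightarrow>
   ereal" where
  "continuity_const \<Omega> p q V T =
     (SUP w\<in>V - {0}. SUP v\<in>V - {0}. ereal (T w v / (W1_seminorm \<Omega> p w * W1_seminorm \<Omega> q v)))"

definition lipschitz_const ::
  "(real \<times> real) set \<Rightarrow> real \<Rightarrow> real \<Rightarrow> plane_fun set \<Rightarrow>
   (plane_fun \<Rightarrow> plane_fun \<Rightarrow> plane_fun \<Rightarrow> real) \<Rightarrow> plane_fun \<Rightarrow> real \<Rightarrow> ereal" where
  "lipschitz_const \<Omega> p q V F' c R =
     (SUP w\<in>fe_ball \<Omega> p V c (ereal R) - {c}.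
        op_norm \<Omega> p q V (\<lambda>h v. F' w h v - F' c h v) / ereal (W1_seminorm \<Omega> p (w - c)))"

end

theory Submission
  imports Defs
begin

text \<open>
  Write \<open>e = p_fe - p_red\<close> for the error, and \<open>|.|\<close> for the seminorms and the dual norm.

  \<^bold>\<open>The estimate.\<close> Since \<open>1 - sqrt (1 - \<tau>) \<le> \<tau>\<close> for \<open>0 \<le> \<tau> \<le> 1\<close>, the estimator is at most
  \<open>(\<beta> / L) * \<tau> = (2 / \<beta>) * (err + res)\<close>. The triangle inequality \<open>res \<le> |F p_red| + err\<close> and
  \<open>err \<le> c_err * res\<close> bound \<open>err + res\<close> by \<open>inverse C_err * |F p_red|\<close>. As \<open>F p_fe = 0\<close>, the mean
  value theorem expresses \<open>F p_red\<close> through \<open>F'\<close> applied to \<open>e\<close> at a point of the segment from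
  \<open>p_red\<close> to \<open>p_fe\<close>, where \<open>F'\<close> differs from its value at \<open>p_red\<close> by at most \<open>L * |e|\<close>; hence
  \<open>|F p_red| \<le> \<gamma> * |e| + L * |e| * |e|\<close>. Finally \<open>L * |e| \<le> \<beta> \<le> \<gamma>\<close> because \<open>p_fe\<close> lies in the ball of
  radius \<open>\<beta> / L\<close>, so \<open>|F p_red| \<le> 2 * \<gamma> * |e|\<close>, and the two factors 2 make up the constant 4. This is
  lemma \<open>estimator_effectivity\<close>, which holds for every linear space \<open>V\<close> contained in both Sobolev
  spaces; its last, purely numerical step is \<open>real_estimate\<close>.

  \<^bold>\<open>Conformity.\<close> The operator \<open>F\<close> is differentiable on \<open>W1_zero \<Omega> p\<close>, with values in the dual of
  \<open>W1_zero \<Omega> q\<close>, so the estimate needs that finite element functions belong to these closures of the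
  test functions (\<open>fe_space_2d_subset_W1_zero\<close>). The approximants are explicit: let \<open>S n\<close> be a smooth
  map of the line that is constant near every mesh node, the identity at distance \<open>2 / n\<close> from the
  nodes, and maps every cell into itself (\<open>flatten\<close>). Composing \<open>v\<close> with such maps in both variables
  gives a function that, near every point, is a polynomial in \<open>S n x\<close> and \<open>T n y\<close>: the flat spots
  hide the kinks of \<open>v\<close> across the mesh lines. So it is smooth, it vanishes near the boundary, and it
  converges to \<open>v\<close> with uniformly bounded, pointwise convergent first derivatives. Dominated
  convergence does the rest (locale \<open>bounded_test_limit\<close>).

  \<^bold>\<open>Weak derivatives.\<close> Seminorms and pairings refer to chosen representatives of weak derivatives.
  That seminorms are homogeneous, and that the projected residual changes sign with its argument (the
  dual norms are suprema without absolute values, so the triangle inequality above uses \<open>-v\<close> along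
  with \<open>v\<close>), rests on the almost everywhere uniqueness of weak derivatives (\<open>weak_deriv_unique\<close>),
  i.e. on the fundamental lemma of the calculus of variations.
\<close>

section \<open>Smooth functions of one variable\<close>

text \<open>
  Recursion on the order of differentiability makes every closure property below an induction with a
  single differentiation rule as its step.
\<close>

primrec ndiff :: "nat \<Rightarrow> (real \<Rightarrow> real) \<Rightarrow> bool" where
  "ndiff 0 f \<longleftrightarrow> True"
| "ndiff (Suc n) f \<longleftrightarrow> (\<exists>f'. (\<forall>x. (f has_real_derivative f' x) (at x)) \<and> ndiff n f')"

definition smooth1 :: "(real \<Rightarrow> real) \<Rightarrow> bool" where
  "smooth1 f \<longleftrightarrow> (\<forall>n. ndiff n f)"

text \<open>
  A rule in which \<open>f'\<close> is fixed by the first premise, so that the derivative can be supplied by a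
  differentiation rule instead of by guessing a witness.
\<close>

lemma ndiff_SucI:
  "(\<And>x. (f has_real_derivative f' x) (at x)) \<Longrightarrow> ndiff n f' \<Longrightarrow> ndiff (Suc n) f"
  by auto

lemma ndiff_SucE:
  assumes "ndiff (Suc n) f"
  obtains f' where "\<And>x. (f has_real_derivative f' x) (at x)" "ndiff n f'"
  using assms by auto

lemma ndiff_SucD: "ndiff (Suc n) f \<Longrightarrow> ndiff n f"
proof (induction n arbitrary: f)
  case (Suc n)
  from Suc.prems show ?case
    by (rule ndiff_SucE) (rule ndiff_SucI, assumption, rule Suc.IH)
qed simp

lemma ndiff_const: "ndiff n (\<lambda>x. c)"
  by (induction n arbitrary: c) (simp, rule ndiff_SucI[OF DERIV_const])

lemma ndiff_ident: "ndiff n (\<lambda>x. x)"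
  by (cases n) (simp, use ndiff_SucI[OF DERIV_ident ndiff_const] in blast)

lemma ndiff_add: "ndiff n f \<Longrightarrow> ndiff n g \<Longrightarrow> ndiff n (\<lambda>x. f x + g x)"
proof (induction n arbitrary: f g)
  case (Suc n)
  obtain f' g' where fg:
    "\<And>x. (f has_real_derivative f' x) (at x)" "ndiff n f'"
    "\<And>x. (g has_real_derivative g' x) (at x)" "ndiff n g'"
    using Suc.prems by auto
  have "((\<lambda>x. f x + g x) has_real_derivative f' x + g' x) (at x)" for x
    by (intro DERIV_add fg)
  then show ?case
    by (rule ndiff_SucI) (rule Suc.IH[OF fg(2,4)])
qed simp

lemma ndiff_mult: "ndiff n f \<Longrightarrow> ndiff n g \<Longrightarrow> ndiff n (\<lambda>x. f x * g x)"
proof (induction n arbitrary: f g)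
  case (Suc n)
  obtain f' g' where fg:
    "\<And>x. (f has_real_derivative f' x) (at x)" "ndiff n f'"
    "\<And>x. (g has_real_derivative g' x) (at x)" "ndiff n g'"
    using Suc.prems by auto
  have "ndiff n f" "ndiff n g"
    using Suc.prems ndiff_SucD by blast+
  then have "ndiff n (\<lambda>x. f' x * g x + g' x * f x)"
    by (intro ndiff_add Suc.IH fg)
  then show ?case
    by (rule ndiff_SucI[rotated]) (intro DERIV_mult fg)
qed simp

lemma ndiff_compose: "ndiff n f \<Longrightarrow> ndiff n g \<Longrightarrow> ndiff n (\<lambda>x. f (g x))"
proof (induction n arbitrary: f g)
  case (Suc n)
  obtain f' g' where fg:
    "\<And>x. (f has_real_derivative f' x) (at x)" "ndiff n f'"
    "\<And>x. (g has_real_derivative g' x) (at x)" "ndiff n g'"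
    using Suc.prems by auto
  have "ndiff n g"
    using Suc.prems ndiff_SucD by blast
  then have "ndiff n (\<lambda>x. f' (g x) * g' x)"
    by (intro ndiff_mult Suc.IH[OF fg(2)] fg(4))
  then show ?case
    by (rule ndiff_SucI[rotated]) (rule DERIV_chain2[OF fg(1,3)])
qed simp

text \<open>
  The derivative of \<open>1 / f\<close> is a product of \<open>f'\<close> and two factors \<open>1 / f\<close>, so differentiability of
  order \<open>n\<close> of the reciprocal reproduces itself in order \<open>n + 1\<close>.
\<close>

lemma ndiff_inverse:
  assumes "\<And>x. f x \<noteq> 0"
  shows "ndiff n f \<Longrightarrow> ndiff n (\<lambda>x. inverse (f x))"
proof (induction n)
  case (Suc n)
  obtain f' where f:
    "\<And>x. (f has_real_derivative f' x) (at x)" "ndiff n f'"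
    using Suc.prems by auto
  have "ndiff n (\<lambda>x. inverse (f x))"
    using Suc ndiff_SucD by blast
  with f have "ndiff n (\<lambda>x. (-1) * ((inverse (f x) * f' x) * inverse (f x)))"
    by (intro ndiff_mult ndiff_const) auto
  then show ?case
    by (rule ndiff_SucI[rotated]) (use f in \<open>auto intro!: derivative_eq_intros assms\<close>)
qed simp

lemma smooth1_const: "smooth1 (\<lambda>x. c)"
  and smooth1_ident: "smooth1 (\<lambda>x. x)"
  and smooth1_add: "smooth1 f \<Longrightarrow> smooth1 g \<Longrightarrow> smooth1 (\<lambda>x. f x + g x)"
  and smooth1_mult: "smooth1 f \<Longrightarrow> smooth1 g \<Longrightarrow> smooth1 (\<lambda>x. f x * g x)"
  and smooth1_compose: "smooth1 f \<Longrightarrow> smooth1 g \<Longrightarrow> smooth1 (\<lambda>x. f (g x))"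
  unfolding smooth1_def
  by (simp_all add: ndiff_const ndiff_ident ndiff_add ndiff_mult ndiff_compose)

lemma smooth1_inverse: "(\<And>x. f x \<noteq> 0) \<Longrightarrow> smooth1 f \<Longrightarrow> smooth1 (\<lambda>x. inverse (f x))"
  unfolding smooth1_def by (intro allI ndiff_inverse) auto

lemma smooth1_diff:
  assumes "smooth1 f" "smooth1 g"
  shows "smooth1 (\<lambda>x. f x - g x)"
  using smooth1_add[OF assms(1) smooth1_mult[OF smooth1_const[of "-1"] assms(2)]] by simp

lemma smooth1_divide:
  assumes "smooth1 f" "smooth1 g" "\<And>x. g x \<noteq> 0"
  shows "smooth1 (\<lambda>x. f x / g x)"
  unfolding divide_inverse by (intro smooth1_mult smooth1_inverse assms)

lemma smooth1_power: "smooth1 f \<Longrightarrow> smooth1 (\<lambda>x. f x ^ a)"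
  by (induction a) (auto intro: smooth1_const smooth1_mult)

lemma smooth1_sum: "(\<And>i. i \<in> I \<Longrightarrow> smooth1 (f i)) \<Longrightarrow> smooth1 (\<lambda>x. \<Sum>i\<in>I. f i x)"
  by (induction I rule: infinite_finite_induct) (auto intro: smooth1_const smooth1_add)

lemmas smooth1_intros =
  smooth1_const smooth1_ident smooth1_add smooth1_mult smooth1_diff smooth1_power smooth1_sum

lemma smooth1_deriv:
  assumes "smooth1 f"
  shows "(f has_real_derivative deriv f x) (at x)" "smooth1 (deriv f)"
proof -
  have *: "(f has_real_derivative deriv f x) (at x)" for x
  proof -
    have "ndiff (Suc 0) f" using assms unfolding smooth1_def by blast
    then show ?thesis by (auto simp: DERIV_deriv_iff_real_differentiable real_differentiable_def)
  qed
  then show "(f has_real_derivative deriv f x) (at x)" .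
  show "smooth1 (deriv f)"
    unfolding smooth1_def
  proof
    fix n
    have "ndiff (Suc n) f" using assms unfolding smooth1_def by blast
    then obtain f' where f': "\<And>x. (f has_real_derivative f' x) (at x)" "ndiff n f'" by auto
    have "f' = deriv f" by (rule ext) (simp add: DERIV_imp_deriv[OF f'(1)])
    with f' show "ndiff n (deriv f)" by simp
  qed
qed

lemma smooth1_higher_deriv: "smooth1 f \<Longrightarrow> smooth1 ((deriv ^^ n) f)"
  by (induction n) (auto intro: smooth1_deriv)

lemma smooth1_continuous_on: "smooth1 f \<Longrightarrow> continuous_on S f"
  using smooth1_deriv(1) by (meson DERIV_continuous continuous_at_imp_continuous_on)

text \<open>
  All derivatives of \<open>exp (- 1 / x)\<close> are combinations of the functions \<open>G k\<close>, which multiply it by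
  \<open>(1 / x) ^ k\<close>, and this family is closed under differentiation. At \<open>0\<close> every difference quotient of
  \<open>G k\<close> tends to \<open>0\<close>, since the exponential beats any power.
\<close>

lemma smooth1_exp_flat: "smooth1 (\<lambda>x. if x > 0 then exp (- (1 / x)) else 0)"
proof -
  define G where "G k x = (if x > 0 then (1 / x) ^ k * exp (- (1 / x)) else (0::real))" for k :: nat and x
  have lim: "((\<lambda>x. (1 / x) ^ k * exp (- (1 / x))) \<longlongrightarrow> (0::real)) (at_right 0)" for k :: nat
  proof -
    have "((\<lambda>t. t ^ k / exp t) \<longlongrightarrow> (0::real)) at_top" by (rule tendsto_power_div_exp_0)
    then have "((\<lambda>x. inverse x ^ k / exp (inverse x)) \<longlongrightarrow> (0::real)) (at_right 0)"
      by (rule filterlim_compose[OF _ filterlim_inverse_at_top_right])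
    then show ?thesis by (simp add: exp_minus field_simps)
  qed
  have der: "(G k has_real_derivative (- real k * G (Suc k) x + G (Suc (Suc k)) x)) (at x)" for k x
  proof (cases x "0::real" rule: linorder_cases)
    case greater
    have ev: "\<forall>\<^sub>F y in nhds x. G k y = (1 / y) ^ k * exp (- (1 / y))"
      using eventually_nhds_in_open[of "{0<..}" x] greater by (auto elim!: eventually_mono simp: G_def)
    have "((\<lambda>y. (1 / y) ^ k * exp (- (1 / y))) has_real_derivative
        (- real k * G (Suc k) x + G (Suc (Suc k)) x)) (at x)"
    proof (rule DERIV_cong)
      show "((\<lambda>y. (1 / y) ^ k * exp (- (1 / y))) has_real_derivative
          real k * (1 / x) ^ (k - 1) * (- ((1 / x) * (1 / x))) * exp (- (1 / x)) +
          (1 / x) ^ k * (exp (- (1 / x)) * ((1 / x) * (1 / x)))) (at x)"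
        using greater by (auto intro!: derivative_eq_intros)
      show "real k * (1 / x) ^ (k - 1) * (- ((1 / x) * (1 / x))) * exp (- (1 / x)) +
          (1 / x) ^ k * (exp (- (1 / x)) * ((1 / x) * (1 / x))) =
          - real k * G (Suc k) x + G (Suc (Suc k)) x"
        using greater by (cases k) (simp_all add: G_def algebra_simps add_divide_distrib diff_divide_distrib)
    qed
    then show ?thesis by (subst DERIV_cong_ev[OF refl ev refl])
  next
    case less
    have ev: "\<forall>\<^sub>F y in nhds x. G k y = 0"
      using eventually_nhds_in_open[of "{..<0}" x] less by (auto elim!: eventually_mono simp: G_def)
    have "((\<lambda>y. 0) has_real_derivative (- real k * G (Suc k) x + G (Suc (Suc k)) x)) (at x)"
      using less by (simp add: G_def)
    then show ?thesis by (subst DERIV_cong_ev[OF refl ev refl])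
  next
    case equal
    have r: "((\<lambda>h. G k h / h) \<longlongrightarrow> 0) (at_right 0)"
      using lim[of "Suc k"]
      by (rule Lim_transform_eventually)
         (auto simp: eventually_at_filter G_def field_simps)
    have l: "((\<lambda>h. G k h / h) \<longlongrightarrow> 0) (at_left 0)"
      by (rule Lim_transform_eventually[OF tendsto_const])
         (auto simp: eventually_at_filter G_def)
    show ?thesis
      using filterlim_split_at[OF l r] equal by (simp add: DERIV_def G_def)
  qed
  have "ndiff n (G k)" for n k
  proof (induction n arbitrary: k)
    case (Suc n)
    show ?case
      by (rule ndiff_SucI[OF der])
         (intro ndiff_add ndiff_mult ndiff_const Suc.IH)
  qed simp
  then have "smooth1 (G 0)" unfolding smooth1_def by blast
  then show ?thesis by (simp add: G_def[abs_def] cong: if_cong)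
qed

text \<open>
  With \<open>e\<close> the flat exponential, \<open>e x / (e x + e (1 - x))\<close> is the standard smooth transition: the
  denominator never vanishes because \<open>x\<close> or \<open>1 - x\<close> is positive.
\<close>

lemma smooth_step_exists:
  "\<exists>g. smooth1 g \<and> (\<forall>x\<le>0. g x = 0) \<and> (\<forall>x\<ge>1. g x = 1) \<and> (\<forall>x. 0 \<le> g x \<and> g x \<le> 1)"
proof -
  define e where "e x = (if x > 0 then exp (- (1 / x)) else (0::real))" for x
  have e: "smooth1 e" using smooth1_exp_flat unfolding e_def[abs_def] .
  have e0: "e x \<ge> 0" for x by (simp add: e_def)
  have pos: "e x + e (1 - x) > 0" for x by (auto simp: e_def add_pos_pos)
  have sm: "smooth1 (\<lambda>x. e (1 - x))" by (rule smooth1_compose[OF e]) (intro smooth1_intros)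
  have "smooth1 (\<lambda>x. e x / (e x + e (1 - x)))"
    using pos by (intro smooth1_divide smooth1_add e sm) (auto simp: less_imp_neq[symmetric] dest: less_imp_neq)
  moreover have "\<forall>x\<le>0. e x / (e x + e (1 - x)) = 0" by (simp add: e_def)
  moreover have "\<forall>x\<ge>1. e x / (e x + e (1 - x)) = 1" by (simp add: e_def)
  moreover have "\<forall>x. 0 \<le> e x / (e x + e (1 - x)) \<and> e x / (e x + e (1 - x)) \<le> 1"
    using pos e0 by (auto simp: divide_le_eq less_imp_le)
  ultimately show ?thesis by blast
qed

definition smooth_step :: "real \<Rightarrow> real" where
  "smooth_step = (SOME g. smooth1 g \<and> (\<forall>x\<le>0. g x = 0) \<and> (\<forall>x\<ge>1. g x = 1) \<and>
     (\<forall>x. 0 \<le> g x \<and> g x \<le> 1))"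

lemma smooth_step:
  shows smooth1_step: "smooth1 smooth_step"
    and smooth_step_0: "\<And>x. x \<le> 0 \<Longrightarrow> smooth_step x = 0"
    and smooth_step_1: "\<And>x. x \<ge> 1 \<Longrightarrow> smooth_step x = 1"
    and smooth_step_range: "\<And>x. 0 \<le> smooth_step x" "\<And>x. smooth_step x \<le> 1"
  using someI_ex[OF smooth_step_exists] unfolding smooth_step_def[symmetric] by auto

section \<open>Smooth and test functions in the plane\<close>

lemma separable_has_derivative:
  assumes "\<And>l. l \<in> L \<Longrightarrow> smooth1 (f l)" "\<And>l. l \<in> L \<Longrightarrow> smooth1 (g l)"
  shows "((\<lambda>z. \<Sum>l\<in>L. f l (fst z) * g l (snd z)) has_derivative
    (\<lambda>(a, b). a * (\<Sum>l\<in>L. deriv (f l) (fst z) * g l (snd z)) +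
              b * (\<Sum>l\<in>L. f l (fst z) * deriv (g l) (snd z)))) (at z)"
proof -
  have *: "((\<lambda>z. h (fst z)) has_derivative (\<lambda>d. deriv h (fst z) * fst d)) (at z)"
    "((\<lambda>z. h (snd z)) has_derivative (\<lambda>d. deriv h (snd z) * snd d)) (at z)"
    if "smooth1 h" for h and z :: "real \<times> real"
    using has_derivative_compose[OF has_derivative_fst[OF has_derivative_ident]
            smooth1_deriv(1)[OF that, of "fst z", unfolded has_field_derivative_def]]
          has_derivative_compose[OF has_derivative_snd[OF has_derivative_ident]
            smooth1_deriv(1)[OF that, of "snd z", unfolded has_field_derivative_def]]
    by simp_all
  have "((\<lambda>z. \<Sum>l\<in>L. f l (fst z) * g l (snd z)) has_derivative
    (\<lambda>d. \<Sum>l\<in>L. f l (fst z) * (deriv (g l) (snd z) * snd d) + deriv (f l) (fst z) * fst d * g l (snd z))) (at z)"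
    by (intro has_derivative_sum has_derivative_mult * assms)
  then show ?thesis
    by (rule has_derivative_eq_rhs)
       (auto simp: fun_eq_iff sum.distrib sum_distrib_left algebra_simps intro!: sum.cong)
qed

lemma higher_deriv_separable:
  assumes "\<And>l. l \<in> L \<Longrightarrow> smooth1 (f l)"
  shows "(deriv ^^ n) (\<lambda>x. \<Sum>l\<in>L. f l x * c l) = (\<lambda>x. \<Sum>l\<in>L. (deriv ^^ n) (f l) x * c l)"
proof (induction n)
  case (Suc n)
  have "deriv (\<lambda>x. \<Sum>l\<in>L. (deriv ^^ n) (f l) x * c l) x = (\<Sum>l\<in>L. (deriv ^^ Suc n) (f l) x * c l)" for x
    using smooth1_deriv(1)[OF smooth1_higher_deriv[OF assms]]
    by (auto intro!: DERIV_imp_deriv DERIV_sum DERIV_cmult_right)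
  with Suc show ?case by auto
qed simp

text \<open>
  Smoothness asks for one family \<open>D i j\<close> of mixed derivatives on the whole plane. Taking iterated
  one-dimensional derivatives as \<open>D i j\<close> makes the family depend on local values only, so it is
  enough to know the function near each point as a sum of products of smooth functions of one
  variable, where the sums may differ from point to point.
\<close>

lemma smooth_fun_locally_separable:
  fixes \<phi> :: plane_fun
  assumes "\<And>x y. \<exists>U W (L :: (nat \<times> nat) set) f g. open U \<and> open W \<and> x \<in> U \<and> y \<in> W \<and>
      (\<forall>l\<in>L. smooth1 (f l) \<and> smooth1 (g l)) \<and>
      (\<forall>x\<in>U. \<forall>y\<in>W. \<phi> (x, y) = (\<Sum>l\<in>L. f l x * g l y))"
  shows "smooth_fun \<phi>"
proof -
  define D where "D i j = (\<lambda>(x, y). (deriv ^^ j) (\<lambda>t. (deriv ^^ i) (\<lambda>s. \<phi> (s, t)) x) y)" for i j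
  have "(D i j has_derivative (\<lambda>(a, b). a * D (Suc i) j z + b * D i (Suc j) z)) (at z)" for i j z
  proof -
    obtain U W f g and L :: "(nat \<times> nat) set" where
      UW: "open U" "open W" "fst z \<in> U" "snd z \<in> W" and
      sm: "\<And>l. l \<in> L \<Longrightarrow> smooth1 (f l)" "\<And>l. l \<in> L \<Longrightarrow> smooth1 (g l)" and
      \<phi>: "\<And>x y. x \<in> U \<Longrightarrow> y \<in> W \<Longrightarrow> \<phi> (x, y) = (\<Sum>l\<in>L. f l x * g l y)"
      using assms[of "fst z" "snd z"] by blast
    have D: "D i j (x, y) = (\<Sum>l\<in>L. (deriv ^^ i) (f l) x * (deriv ^^ j) (g l) y)"
      if "x \<in> U" "y \<in> W" for i j x y
    proof -
      have in1: "(deriv ^^ i) (\<lambda>s. \<phi> (s, t)) x = (\<Sum>l\<in>L. (deriv ^^ i) (f l) x * g l t)" if "t \<in> W" for t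
      proof -
        have "(deriv ^^ i) (\<lambda>s. \<phi> (s, t)) x = (deriv ^^ i) (\<lambda>s. \<Sum>l\<in>L. f l s * g l t) x"
          using eventually_nhds_in_open[OF UW(1) \<open>x \<in> U\<close>] \<phi> that
          by (intro higher_deriv_cong_ev) (auto elim!: eventually_mono)
        then show ?thesis by (simp add: higher_deriv_separable[OF sm(1)])
      qed
      have "D i j (x, y) = (deriv ^^ j) (\<lambda>t. \<Sum>l\<in>L. g l t * (deriv ^^ i) (f l) x) y"
        unfolding D_def prod.case using eventually_nhds_in_open[OF UW(2) \<open>y \<in> W\<close>] in1
        by (intro higher_deriv_cong_ev) (auto elim!: eventually_mono simp: mult.commute)
      then show ?thesis by (simp add: higher_deriv_separable[OF sm(2)] mult.commute)
    qed
    have "((\<lambda>z. \<Sum>l\<in>L. (deriv ^^ i) (f l) (fst z) * (deriv ^^ j) (g l) (snd z)) has_derivative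
       (\<lambda>(a, b). a * (\<Sum>l\<in>L. deriv ((deriv ^^ i) (f l)) (fst z) * (deriv ^^ j) (g l) (snd z)) +
        b * (\<Sum>l\<in>L. (deriv ^^ i) (f l) (fst z) * deriv ((deriv ^^ j) (g l)) (snd z)))) (at z)"
      by (intro separable_has_derivative smooth1_higher_deriv sm)
    then have "(D i j has_derivative
       (\<lambda>(a, b). a * (\<Sum>l\<in>L. deriv ((deriv ^^ i) (f l)) (fst z) * (deriv ^^ j) (g l) (snd z)) +
        b * (\<Sum>l\<in>L. (deriv ^^ i) (f l) (fst z) * deriv ((deriv ^^ j) (g l)) (snd z)))) (at z)"
      by (rule has_derivative_transform_within_open[where s = "U \<times> W"])
         (use UW D in \<open>auto simp: mem_Times_iff open_Times\<close>)
    moreover have "D (Suc i) j z = (\<Sum>l\<in>L. deriv ((deriv ^^ i) (f l)) (fst z) * (deriv ^^ j) (g l) (snd z))"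
      "D i (Suc j) z = (\<Sum>l\<in>L. (deriv ^^ i) (f l) (fst z) * deriv ((deriv ^^ j) (g l)) (snd z))"
      using D[OF UW(3,4)] by simp_all
    ultimately show ?thesis by simp
  qed
  moreover have "D 0 0 = \<phi>" by (simp add: D_def fun_eq_iff)
  ultimately show ?thesis unfolding smooth_fun_def by blast
qed

lemma smooth_fun_C1:
  assumes "smooth_fun \<phi>"
  shows "(\<phi> has_derivative frechet_derivative \<phi> (at z)) (at z)"
    and "continuous_on UNIV \<phi>"
    and "continuous_on UNIV (\<lambda>z. frechet_derivative \<phi> (at z) e)"
proof -
  obtain D where D0: "D 0 0 = \<phi>" and
    D: "\<And>i j z. (D i j has_derivative (\<lambda>(a, b). a * D (Suc i) j z + b * D i (Suc j) z)) (at z)"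
    using assms unfolding smooth_fun_def by metis
  have cont: "continuous_on UNIV (D i j)" for i j
    using has_derivative_continuous[OF D] by (simp add: continuous_on_eq_continuous_at)
  have der: "(\<phi> has_derivative (\<lambda>(a, b). a * D (Suc 0) 0 z + b * D 0 (Suc 0) z)) (at z)" for z
    using D[of 0 0 z] D0 by simp
  have fd: "frechet_derivative \<phi> (at z) = (\<lambda>(a, b). a * D (Suc 0) 0 z + b * D 0 (Suc 0) z)" for z
    using frechet_derivative_at[OF der] by simp
  show "(\<phi> has_derivative frechet_derivative \<phi> (at z)) (at z)" using der unfolding fd .
  show "continuous_on UNIV \<phi>" using cont[of 0 0] D0 by simp
  show "continuous_on UNIV (\<lambda>z. frechet_derivative \<phi> (at z) e)"
    unfolding fd by (auto simp: case_prod_beta intro!: continuous_intros cont)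
qed

lemma continuous_compact_support_bounded:
  fixes h :: "'a::euclidean_space \<Rightarrow> real"
  assumes "continuous_on UNIV h" "compact K" "\<And>z. z \<notin> K \<Longrightarrow> h z = 0"
  obtains B where "0 \<le> B" "\<And>z. \<bar>h z\<bar> \<le> B"
proof -
  have "compact (h ` K)"
    using assms(1,2) by (intro compact_continuous_image) (auto intro: continuous_on_subset)
  then obtain B where "\<And>x. x \<in> h ` K \<Longrightarrow> norm x \<le> B"
    using compact_imp_bounded bounded_iff by metis
  then have "\<bar>h z\<bar> \<le> max B 0" for z
    using assms(3)[of z] by (cases "z \<in> K") (auto simp: le_max_iff_disj)
  then show ?thesis by (intro that[of "max B 0"]) auto
qed

lemma continuous_compact_support_integrable:
  fixes h :: "'a::euclidean_space \<Rightarrow> real"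
  assumes "continuous_on UNIV h" "compact K" "\<And>z. z \<notin> K \<Longrightarrow> h z = 0"
  shows "integrable lborel h"
proof -
  have "integrable lborel (\<lambda>z. indicator K z *\<^sub>R h z)"
    using assms by (intro borel_integrable_compact) (auto intro: continuous_on_subset)
  also have "(\<lambda>z. indicator K z *\<^sub>R h z) = h"
    using assms(3) by (auto simp: fun_eq_iff indicator_def)
  finally show ?thesis .
qed

text \<open>
  By translation invariance every difference quotient of \<open>h\<close> has integral zero. The quotients are
  bounded by the mean value theorem and supported in a common compact set, so dominated convergence
  passes to the derivative.
\<close>

lemma integral_directional_derivative_zero:
  fixes h :: "'a::euclidean_space \<Rightarrow> real"
  assumes der: "\<And>z. (h has_derivative h' z) (at z)"
    and cont: "continuous_on UNIV (\<lambda>z. h' z e)"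
    and K: "compact K" "\<And>z. z \<notin> K \<Longrightarrow> h z = 0" "\<And>z. z \<notin> K \<Longrightarrow> h' z e = 0"
  shows "(LINT z|lborel. h' z e) = 0"
proof -
  define d where "d n = inverse (real (Suc n))" for n
  define s where "s n z = (h (z + d n *\<^sub>R e) - h z) / d n" for n z
  have d: "0 < d n" "d n \<le> 1" for n by (auto simp: d_def inverse_le_1_iff)
  have ch: "continuous_on UNIV h"
    using has_derivative_continuous[OF der] by (simp add: continuous_on_eq_continuous_at)
  obtain B where B: "0 \<le> B" "\<And>z. \<bar>h' z e\<bar> \<le> B"
    using continuous_compact_support_bounded[OF cont K(1,3)] by metis
  have line: "((\<lambda>t. h (z + t *\<^sub>R e)) has_real_derivative h' (z + t *\<^sub>R e) e) (at t)" for z t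
  proof -
    have "((\<lambda>t. z + t *\<^sub>R e) has_derivative (\<lambda>t. t *\<^sub>R e)) (at t)"
      by (auto intro!: derivative_eq_intros)
    from has_derivative_compose[OF this der]
    have "((\<lambda>t. h (z + t *\<^sub>R e)) has_derivative (\<lambda>u. h' (z + t *\<^sub>R e) (u *\<^sub>R e))) (at t)" .
    moreover have "h' (z + t *\<^sub>R e) (u *\<^sub>R e) = h' (z + t *\<^sub>R e) e * u" for u
      using linear_scale[OF has_derivative_linear[OF der]] by (simp add: mult.commute)
    ultimately show ?thesis by (simp add: has_field_derivative_def)
  qed
  \<comment> \<open>All quotients vanish outside \<open>K'\<close>, as the step lengths \<open>d n\<close> are at most 1.\<close>
  define K' where "K' = {x - y |x y. x \<in> K \<and> y \<in> closed_segment 0 e}"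
  have cK': "compact K'"
    unfolding K'_def using K(1) by (intro compact_differences) auto
  have sbound: "norm (s n z) \<le> B * indicator K' z" for n z
  proof -
    obtain t where t: "0 < t" "t < d n" "h (z + d n *\<^sub>R e) - h (z + 0 *\<^sub>R e) = (d n - 0) * h' (z + t *\<^sub>R e) e"
      using MVT2[OF d(1)[of n] line[of z]] by blast
    then have s: "s n z = h' (z + t *\<^sub>R e) e" using d(1)[of n] by (simp add: s_def field_simps)
    show ?thesis
    proof (cases "z \<in> K'")
      case False
      have "z = (z + t *\<^sub>R e) - t *\<^sub>R e" "t *\<^sub>R e \<in> closed_segment 0 e"
        using t d(2)[of n] by (auto simp: closed_segment_def)
      with False have "z + t *\<^sub>R e \<notin> K" unfolding K'_def by blast
      then show ?thesis using s K(3) B(1) by simp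
    qed (use s B in simp)
  qed
  have slim: "(\<lambda>n. s n z) \<longlonglongrightarrow> h' z e" for z
  proof -
    have "((\<lambda>t. (h (z + (0 + t) *\<^sub>R e) - h (z + 0 *\<^sub>R e)) / t) \<longlongrightarrow> h' (z + 0 *\<^sub>R e) e) (at 0)"
      using line[of z 0] unfolding DERIV_def .
    moreover have "filterlim d (at 0) sequentially"
      unfolding d_def filterlim_at using LIMSEQ_inverse_real_of_nat by (auto intro!: always_eventually)
    ultimately have "(\<lambda>n. (h (z + (0 + d n) *\<^sub>R e) - h (z + 0 *\<^sub>R e)) / d n) \<longlonglongrightarrow> h' (z + 0 *\<^sub>R e) e"
      by (rule filterlim_compose)
    then show ?thesis by (simp add: s_def)
  qed
  have [measurable]: "h \<in> borel_measurable borel" "(\<lambda>z. h' z e) \<in> borel_measurable borel"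
    using ch cont by (auto intro: borel_measurable_continuous_onI)
  have hi: "integrable lborel h"
    using continuous_compact_support_integrable[OF ch K(1,2)] .
  have shift: "integrable lborel (\<lambda>z. h (c + z)) \<and> (LINT z|lborel. h (c + z)) = integral\<^sup>L lborel h" for c
  proof -
    have "integral\<^sup>L (distr lborel borel ((+) c)) h = (LINT z|lborel. h (c + z))"
      by (rule integral_distr) simp_all
    moreover have "integrable (distr lborel borel ((+) c)) h \<longleftrightarrow> integrable lborel (\<lambda>z. h (c + z))"
      by (rule integrable_distr_eq) simp_all
    ultimately show ?thesis using hi by (simp add: lborel_distr_plus)
  qed
  have s0: "integral\<^sup>L lborel (s n) = 0" for n
    using shift[of "d n *\<^sub>R e"] hi by (simp add: s_def[abs_def] add.commute)
  have "(\<lambda>n. integral\<^sup>L lborel (s n)) \<longlonglongrightarrow> (LINT z|lborel. h' z e)"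
  proof (rule integral_dominated_convergence[where w = "\<lambda>z. B * indicator K' z"])
    show "integrable lborel (\<lambda>z. B * indicator K' z)"
      using emeasure_compact_finite[OF cK'] borel_compact[OF cK']
      by (intro integrable_mult_right integrable_real_indicator) auto
  qed (use slim sbound in \<open>auto simp: s_def[abs_def]\<close>)
  then show ?thesis using s0 LIMSEQ_unique by (simp add: LIMSEQ_const_iff)
qed

lemma test_fun_support:
  assumes "\<phi> \<in> test_funs \<Omega>"
  obtains K where "compact K" "K \<subseteq> \<Omega>" "\<And>z. z \<notin> K \<Longrightarrow> \<phi> z = 0"
    "\<And>z e. z \<notin> K \<Longrightarrow> frechet_derivative \<phi> (at z) e = 0"
proof -
  obtain K where K: "compact K" "K \<subseteq> \<Omega>" "\<And>z. z \<notin> K \<Longrightarrow> \<phi> z = 0"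
    using assms unfolding test_funs_def by blast
  have "frechet_derivative \<phi> (at z) e = 0" if "z \<notin> K" for z e
  proof -
    have "((\<lambda>z. 0) has_derivative (\<lambda>_. 0)) (at z)" by simp
    then have "(\<phi> has_derivative (\<lambda>_. 0)) (at z)"
      by (rule has_derivative_transform_within_open[where s = "- K"])
         (use that K compact_imp_closed[OF K(1)] in auto)
    from frechet_derivative_at[OF this] show ?thesis by (metis)
  qed
  with K show ?thesis using that by blast
qed

lemma test_fun_smooth: "\<phi> \<in> test_funs \<Omega> \<Longrightarrow> smooth_fun \<phi>"
  by (simp add: test_funs_def)

lemmas test_fun_C1 = smooth_fun_C1[OF test_fun_smooth]

lemma test_fun_measurable [measurable]:
  assumes "\<phi> \<in> test_funs \<Omega>"
  shows "\<phi> \<in> borel_measurable borel" "(\<lambda>z. frechet_derivative \<phi> (at z) e) \<in> borel_measurable borel"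
  by (rule borel_measurable_continuous_onI test_fun_C1(2,3)[OF assms])+

lemma test_fun_bounded:
  assumes "\<phi> \<in> test_funs \<Omega>"
  obtains B where "0 \<le> B" "\<And>z. \<bar>\<phi> z\<bar> \<le> B" "\<And>z. \<bar>frechet_derivative \<phi> (at z) e\<bar> \<le> B"
proof -
  obtain K where K: "compact K" "\<And>z. z \<notin> K \<Longrightarrow> \<phi> z = 0"
    "\<And>z e. z \<notin> K \<Longrightarrow> frechet_derivative \<phi> (at z) e = 0"
    using test_fun_support[OF assms] by metis
  obtain B1 where B1: "0 \<le> B1" "\<And>z. \<bar>\<phi> z\<bar> \<le> B1"
    using continuous_compact_support_bounded[OF test_fun_C1(2)[OF assms] K(1,2)] by metis
  obtain B2 where B2: "0 \<le> B2" "\<And>z. \<bar>frechet_derivative \<phi> (at z) e\<bar> \<le> B2"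
    using continuous_compact_support_bounded[OF test_fun_C1(3)[OF assms] K(1,3)] by metis
  show ?thesis
    using B1 B2 by (intro that[of "max B1 B2"]) (auto simp: le_max_iff_disj)
qed

text \<open>
  Integration by parts: the product \<open>\<phi> * \<psi>\<close> is continuously differentiable with compact support, so
  its derivative integrates to zero.
\<close>

lemma test_fun_has_weak_deriv:
  assumes \<phi>: "\<phi> \<in> test_funs \<Omega>"
  shows "has_weak_deriv \<Omega> e \<phi> (\<lambda>z. frechet_derivative \<phi> (at z) e)"
  unfolding has_weak_deriv_def
proof (intro conjI allI impI ballI)
  fix K :: "(real \<times> real) set" assume "compact K \<and> K \<subseteq> \<Omega>"
  then show "set_integrable lborel K \<phi>" "set_integrable lborel K (\<lambda>z. frechet_derivative \<phi> (at z) e)"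
    unfolding set_integrable_def
    by (intro borel_integrable_compact continuous_on_subset[OF test_fun_C1(2)[OF \<phi>]]
        continuous_on_subset[OF test_fun_C1(3)[OF \<phi>]]; simp)+
next
  fix \<psi> assume \<psi>: "\<psi> \<in> test_funs \<Omega>"
  note C\<phi> = test_fun_C1[OF \<phi>] and C\<psi> = test_fun_C1[OF \<psi>]
  obtain K where K: "compact K" "K \<subseteq> \<Omega>" "\<And>z. z \<notin> K \<Longrightarrow> \<psi> z = 0"
    "\<And>z e. z \<notin> K \<Longrightarrow> frechet_derivative \<psi> (at z) e = 0"
    using test_fun_support[OF \<psi>] by metis
  let ?a = "\<lambda>z. \<phi> z * frechet_derivative \<psi> (at z) e" and ?b = "\<lambda>z. frechet_derivative \<phi> (at z) e * \<psi> z"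
  have int: "integrable lborel ?a" "integrable lborel ?b"
    by (rule continuous_compact_support_integrable[OF _ K(1)]; (intro continuous_on_mult C\<phi> C\<psi>)?; simp add: K)+
  have "(LINT z|lborel. ?a z + ?b z) = 0"
  proof (rule integral_directional_derivative_zero[where K = K and h = "\<lambda>z. \<phi> z * \<psi> z" and e = e and
      h' = "\<lambda>z e. \<phi> z * frechet_derivative \<psi> (at z) e + frechet_derivative \<phi> (at z) e * \<psi> z"])
    show "((\<lambda>z. \<phi> z * \<psi> z) has_derivative
        (\<lambda>e. \<phi> z * frechet_derivative \<psi> (at z) e + frechet_derivative \<phi> (at z) e * \<psi> z)) (at z)" for z
      by (rule has_derivative_mult[OF C\<phi>(1) C\<psi>(1)])
    show "continuous_on UNIV (\<lambda>z. \<phi> z * frechet_derivative \<psi> (at z) e + frechet_derivative \<phi> (at z) e * \<psi> z)"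
      by (intro continuous_on_add continuous_on_mult C\<phi> C\<psi>)
  qed (simp_all add: K)
  with int have "integral\<^sup>L lborel ?a = - integral\<^sup>L lborel ?b" by simp
  moreover have "(LINT z:\<Omega>|lborel. ?a z) = integral\<^sup>L lborel ?a" "(LINT z:\<Omega>|lborel. ?b z) = integral\<^sup>L lborel ?b"
    unfolding set_lebesgue_integral_def
    using K(2) by (auto intro!: Bochner_Integration.integral_cong K simp: indicator_def subset_iff)
  ultimately show "(LINT z:\<Omega>|lborel. ?a z) = - (LINT z:\<Omega>|lborel. ?b z)" by simp
qed

section \<open>Uniqueness of weak derivatives\<close>

definition bump :: "real \<Rightarrow> real \<Rightarrow> nat \<Rightarrow> real \<Rightarrow> real" where
  "bump a b n x = smooth_step (real n * (x - a)) * smooth_step (real n * (b - x))"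

lemma bump_range: "0 \<le> bump a b n x" "bump a b n x \<le> 1"
  unfolding bump_def using smooth_step_range by (auto intro: mult_le_one)

lemma bump_outside: "x \<notin> {a<..<b} \<Longrightarrow> bump a b n x = 0"
  by (auto simp: bump_def smooth_step_0 mult_nonneg_nonpos not_less)

lemma smooth1_bump: "smooth1 (bump a b n)"
  unfolding bump_def[abs_def]
  by (intro smooth1_mult smooth1_compose[OF smooth1_step] smooth1_intros)

lemma eventually_ge_linear: "0 < c \<Longrightarrow> \<forall>\<^sub>F n in sequentially. d \<le> real n * c"
  by real_asymp

lemma bump_tendsto: "(\<lambda>n. bump a b n x) \<longlonglongrightarrow> indicator {a<..<b} x"
proof (cases "x \<in> {a<..<b}")
  case True
  have "\<forall>\<^sub>F n in sequentially. bump a b n x = 1"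
    using eventually_ge_linear[of "x - a" 1] eventually_ge_linear[of "b - x" 1] True
    by (auto elim: eventually_elim2 simp: bump_def smooth_step_1)
  then show ?thesis using True by (auto intro: tendsto_eventually)
qed (simp add: bump_outside)

lemma box_bump_test_fun:
  assumes "cbox (a, c) (b, d) \<subseteq> \<Omega>"
  shows "(\<lambda>z. bump a b n (fst z) * bump c d n (snd z)) \<in> test_funs \<Omega>"
proof -
  have "smooth_fun (\<lambda>z. bump a b n (fst z) * bump c d n (snd z))"
    by (rule smooth_fun_locally_separable,
        rule exI[of _ UNIV], rule exI[of _ UNIV], rule exI[of _ "{(0, 0)}"],
        rule exI[of _ "\<lambda>_. bump a b n"], rule exI[of _ "\<lambda>_. bump c d n"])
       (auto intro: smooth1_bump)
  moreover have "bump a b n (fst z) * bump c d n (snd z) = 0" if "z \<notin> cbox (a, c) (b, d)" for z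
    using that by (cases z) (auto simp: cbox_Pair_eq bump_outside)
  ultimately show ?thesis
    using assms compact_cbox unfolding test_funs_def by blast
qed

text \<open>
  The sets over which \<open>G\<close> integrates to zero form a Dynkin system, for which the boxes are a
  generator stable under intersection; so they comprise all Borel sets. The total integral is needed
  for complements.
\<close>

lemma AE_zero_if_box_integrals_zero:
  fixes G :: "'a::euclidean_space \<Rightarrow> real"
  assumes G: "integrable lborel G" and tot: "integral\<^sup>L lborel G = 0"
    and box: "\<And>a b. (LINT z:box a b|lborel. G z) = 0"
  shows "AE z in lborel. G z = 0"
proof (rule sigma_finite_measure.density_zero[OF sigma_finite_lborel G])
  have si: "set_integrable lborel A G" if "A \<in> sets borel" for A
    using G that unfolding set_integrable_def by (intro integrable_mult_indicator) auto
  fix A :: "'a set" assume "A \<in> sets lborel"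
  then have "A \<in> sigma_sets UNIV (range (\<lambda>(a, b). box a b))"
    by (simp add: borel_eq_box)
  have sub: "sigma_sets UNIV (range (\<lambda>(a, b). box a b)) = sets (borel :: 'a measure)"
    by (simp add: borel_eq_box)
  show "(LINT z:A|lborel. G z) = 0"
  proof (rule sigma_sets_induct_disjoint[of "range (\<lambda>(a, b). box a b)" UNIV A])
    show "Int_stable (range (\<lambda>(a, b). box a b :: 'a set))"
      by (auto simp: Int_stable_def box_Int_box)
    show "A \<in> sigma_sets UNIV (range (\<lambda>(a, b). box a b))" by fact
    show "(LINT z:X|lborel. G z) = 0" if "X \<in> range (\<lambda>(a, b). box a b)" for X
      using that box by auto
    show "(LINT z:{}|lborel. G z) = 0" by (simp add: set_lebesgue_integral_def)
    fix X assume X: "X \<in> sigma_sets UNIV (range (\<lambda>(a, b). box a b))" "(LINT z:X|lborel. G z) = 0"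
    have "(LINT z:(X \<union> (UNIV - X))|lborel. G z) = (LINT z:X|lborel. G z) + (LINT z:UNIV - X|lborel. G z)"
      using X(1) unfolding sub by (intro set_integral_Un si) auto
    then show "(LINT z:UNIV - X|lborel. G z) = 0"
      using X tot by (simp add: set_lebesgue_integral_def)
  next
    fix A :: "nat \<Rightarrow> 'a set"
    assume A: "disjoint_family A" "range A \<subseteq> sigma_sets UNIV (range (\<lambda>(a, b). box a b))"
      "\<And>i. (LINT z:A i|lborel. G z) = 0"
    then have "A i \<in> sets borel" for i unfolding sub by auto
    then have "(LINT z:\<Union> (range A)|lborel. G z) = (\<Sum>i. LINT z:A i|lborel. G z)"
      using A(1) by (intro lebesgue_integral_countable_add si)
        (auto simp: disjoint_family_on_def)
    then show "(LINT z:\<Union> (range A)|lborel. G z) = 0" by (simp add: A(3))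
  qed auto
qed

lemma open_countable_cboxes:
  fixes \<Omega> :: "'a::euclidean_space set"
  assumes "open \<Omega>"
  obtains \<C> where "countable \<C>" "\<And>C. C \<in> \<C> \<Longrightarrow> \<exists>a b. C = cbox a b \<and> C \<subseteq> \<Omega>" "\<Omega> = \<Union>\<C>"
proof -
  let ?a = "\<lambda>f. (\<Sum>(i::'a)\<in>Basis. fst (f i) *\<^sub>R i)" and ?b = "\<lambda>f. (\<Sum>(i::'a)\<in>Basis. snd (f i) *\<^sub>R i)"
  let ?I = "{f \<in> Basis \<rightarrow>\<^sub>E \<rat> \<times> \<rat>. cbox (?a f) (?b f) \<subseteq> \<Omega>}"
  have "countable ?I"
    by (rule countable_subset[OF _ countable_PiE[of Basis "\<lambda>_. \<rat> \<times> \<rat>"]]) (auto simp: countable_rat)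
  then have "countable ((\<lambda>f. cbox (?a f) (?b f)) ` ?I)" by (rule countable_image)
  moreover have "\<Omega> = \<Union>((\<lambda>f. cbox (?a f) (?b f)) ` ?I)"
    using open_UNION_cbox[OF assms] by simp
  ultimately show ?thesis by (intro that) blast+
qed

text \<open>
  An open set is a countable union of compact boxes, and measurability can be checked on each of them.
\<close>

lemma locally_integrable_measurable:
  fixes g :: "'a::euclidean_space \<Rightarrow> real"
  assumes "open \<Omega>" "\<And>K. compact K \<Longrightarrow> K \<subseteq> \<Omega> \<Longrightarrow> set_integrable lborel K g"
  shows "set_borel_measurable lborel \<Omega> g"
proof -
  obtain \<C> where C: "countable \<C>" "\<And>C. C \<in> \<C> \<Longrightarrow> \<exists>a b. C = cbox a b \<and> C \<subseteq> \<Omega>" "\<Omega> = \<Union>\<C>"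
    using open_countable_cboxes[OF assms(1)] by metis
  have "(\<lambda>z. indicator \<Omega> z *\<^sub>R g z) \<in> borel_measurable lborel"
  proof (rule measurable_piecewise_restrict[of "insert (- \<Omega>) \<C>"])
    fix C assume "C \<in> insert (- \<Omega>) \<C>"
    then consider "C = - \<Omega>" | "C \<in> \<C>" by blast
    then have "C \<in> sets borel \<and> (\<lambda>z. indicator \<Omega> z *\<^sub>R g z) \<in> borel_measurable (restrict_space lborel C)"
    proof cases
      case 1
      then have "(\<lambda>z. indicator \<Omega> z *\<^sub>R g z) \<in> borel_measurable (restrict_space lborel C) \<longleftrightarrow>
          (\<lambda>z. 0 :: real) \<in> borel_measurable (restrict_space lborel C)"
        by (intro measurable_cong) (auto simp: space_restrict_space)
      then show ?thesis using 1 assms(1) by auto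
    next
      case 2
      then obtain a b where ab: "C = cbox a b" "C \<subseteq> \<Omega>" using C(2) by blast
      then have "(\<lambda>z. indicator C z *\<^sub>R g z) \<in> borel_measurable lborel"
        using assms(2)[of C] compact_cbox unfolding set_integrable_def by auto
      also have "(\<lambda>z. indicator C z *\<^sub>R g z) = (\<lambda>z. indicator C z *\<^sub>R (indicator \<Omega> z *\<^sub>R g z))"
        using ab(2) by (auto simp: fun_eq_iff indicator_def)
      finally show ?thesis
        using ab(1) by (subst borel_measurable_restrict_space_iff) auto
    qed
    then show "C \<inter> space lborel \<in> sets lborel"
      "(\<lambda>z. indicator \<Omega> z *\<^sub>R g z) \<in> borel_measurable (restrict_space lborel C)" by auto
  qed (use C in auto)
  then show ?thesis by (simp add: set_borel_measurable_def)
qed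

text \<open>
  Products of bumps converge to the indicator of an open box, boundedly and within the box, so
  orthogonality to test functions carries over to it.
\<close>

lemma box_integral_zero_if_orthogonal_to_test_funs:
  assumes int: "\<And>K. compact K \<Longrightarrow> K \<subseteq> \<Omega> \<Longrightarrow> set_integrable lborel K g"
    and orth: "\<And>\<phi>. \<phi> \<in> test_funs \<Omega> \<Longrightarrow> (LINT z:\<Omega>|lborel. g z * \<phi> z) = 0"
    and box: "cbox p q \<subseteq> \<Omega>"
  shows "(LINT z:box p q|lborel. g z) = 0"
proof -
  obtain a c b d where pq: "p = (a, c)" "q = (b, d)" by fastforce
  let ?s = "\<lambda>n z. bump a b n (fst z) * bump c d n (snd z)"
  have sub: "box p q \<subseteq> \<Omega>" using box box_subset_cbox by blast
  have out: "?s n z = 0" if "z \<notin> box p q" for n z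
    using that by (cases z) (auto simp: pq box_def Basis_prod_def bump_outside)
  have gi: "set_integrable lborel (box p q) g"
    by (rule set_integrable_subset[OF int[OF compact_cbox box]]) (auto simp: box_subset_cbox)
  have gm: "(\<lambda>z. indicator (box p q) z * g z) \<in> borel_measurable borel"
    using gi unfolding set_integrable_def by auto
  have "(\<lambda>n. LINT z|lborel. (indicator (box p q) z * g z) * ?s n z) \<longlonglongrightarrow> (LINT z|lborel. indicator (box p q) z * g z)"
  proof (rule integral_dominated_convergence[where w = "\<lambda>z. \<bar>indicator (box p q) z * g z\<bar>"])
    show "integrable lborel (\<lambda>z. \<bar>indicator (box p q) z * g z\<bar>)"
      using gi unfolding set_integrable_def by (intro integrable_abs) simp
    show "AE z in lborel. (\<lambda>n. indicat_real (box p q) z * g z * ?s n z) \<longlonglongrightarrow> indicator (box p q) z * g z"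
    proof (intro AE_I2)
      fix z
      have "(\<lambda>n. ?s n z) \<longlonglongrightarrow> indicator {a<..<b} (fst z) * indicator {c<..<d} (snd z)"
        by (intro tendsto_mult bump_tendsto)
      from tendsto_mult[OF tendsto_const this]
      show "(\<lambda>n. indicat_real (box p q) z * g z * ?s n z) \<longlonglongrightarrow> indicator (box p q) z * g z"
        by (rule tendsto_eq_rhs) (cases z, auto simp: pq indicator_def box_def Basis_prod_def)
    qed
    show "AE z in lborel. norm (indicat_real (box p q) z * g z * ?s n z) \<le> \<bar>indicator (box p q) z * g z\<bar>" for n
    proof (intro AE_I2)
      fix z
      have "0 \<le> ?s n z" "?s n z \<le> 1"
        by (simp_all add: bump_range mult_le_one)
      then show "norm (indicat_real (box p q) z * g z * ?s n z) \<le> \<bar>indicator (box p q) z * g z\<bar>"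
        unfolding real_norm_def abs_mult[of _ "?s n z"] by (intro mult_left_le) auto
    qed
    show "(\<lambda>z. indicat_real (box p q) z * g z * ?s n z) \<in> borel_measurable lborel" for n
      using gm borel_measurable_continuous_onI[OF smooth1_continuous_on[OF smooth1_bump]]
      by (auto intro!: borel_measurable_times measurable_compose[OF measurable_fst] measurable_compose[OF measurable_snd] simp: borel_prod[symmetric])
    show "(\<lambda>z. indicat_real (box p q) z * g z) \<in> borel_measurable lborel" using gm by simp
  qed
  moreover have "(LINT z|lborel. (indicator (box p q) z * g z) * ?s n z) = 0" for n
  proof -
    have "(LINT z|lborel. (indicator (box p q) z * g z) * ?s n z) = (LINT z:\<Omega>|lborel. g z * ?s n z)"
      unfolding set_lebesgue_integral_def
    proof (rule Bochner_Integration.integral_cong[OF refl])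
      fix z
      show "indicat_real (box p q) z * g z * ?s n z = indicat_real \<Omega> z *\<^sub>R (g z * ?s n z)"
        using out[of z n] sub by (cases "z \<in> box p q") auto
    qed
    also have "\<dots> = 0" using orth[OF box_bump_test_fun] box unfolding pq by blast
    finally show ?thesis .
  qed
  ultimately show ?thesis by (simp add: LIMSEQ_const_iff set_lebesgue_integral_def)
qed

text \<open>
  The fundamental lemma of the calculus of variations. On a box whose closure lies in \<open>\<Omega>\<close> the function
  \<open>g\<close> is integrable and its integrals over all subboxes vanish; countably many such boxes cover \<open>\<Omega>\<close>.
\<close>

lemma AE_zero_if_orthogonal_to_test_funs:
  assumes "open \<Omega>"
    and int: "\<And>K. compact K \<Longrightarrow> K \<subseteq> \<Omega> \<Longrightarrow> set_integrable lborel K g"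
    and orth: "\<And>\<phi>. \<phi> \<in> test_funs \<Omega> \<Longrightarrow> (LINT z:\<Omega>|lborel. g z * \<phi> z) = 0"
  shows "AE z in lborel. z \<in> \<Omega> \<longrightarrow> g z = 0"
proof -
  let ?B = "(\<lambda>(a, b). box a b) ` {(a, b). cbox a b \<subseteq> \<Omega>}"
  have loc: "AE z in lborel. z \<in> box a b \<longrightarrow> g z = 0" if ab: "cbox a b \<subseteq> \<Omega>" for a b
  proof -
    have "AE z in lborel. indicator (box a b) z * g z = 0"
    proof (rule AE_zero_if_box_integrals_zero)
      show "integrable lborel (\<lambda>z. indicator (box a b) z * g z)"
        using set_integrable_subset[OF int[OF compact_cbox ab], of "box a b"]
        by (simp add: set_integrable_def box_subset_cbox)
      show "(LINT z|lborel. indicator (box a b) z * g z) = 0"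
        using box_integral_zero_if_orthogonal_to_test_funs[OF int orth ab]
        by (simp add: set_lebesgue_integral_def)
      fix c d
      obtain p q where pq: "box a b \<inter> box c d = box p q" "cbox a b \<inter> cbox c d = cbox p q"
        using that box_Int_box[of a b c d] Int_interval[of a b c d] by blast
      have "(LINT z:box c d|lborel. indicator (box a b) z * g z) = (LINT z:box p q|lborel. g z)"
        unfolding pq(1)[symmetric] set_lebesgue_integral_def
        by (auto intro!: Bochner_Integration.integral_cong simp: indicator_def)
      also have "\<dots> = 0"
        using ab pq(2) by (intro box_integral_zero_if_orthogonal_to_test_funs[OF int orth]) auto
      finally show "(LINT z:box c d|lborel. indicator (box a b) z * g z) = 0" .
    qed
    then show ?thesis by eventually_elim (auto simp: indicator_def)
  qed
  obtain \<D> where D: "\<D> \<subseteq> ?B" "countable \<D>" "\<Union>\<D> = \<Union>?B"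
    using Lindelof[of ?B] by force
  have "\<Omega> \<subseteq> \<Union>?B"
  proof
    fix z assume "z \<in> \<Omega>"
    then obtain a b where "z \<in> box a b" "cbox a b \<subseteq> \<Omega>"
      using open_contains_cbox[OF \<open>open \<Omega>\<close>] by metis
    then show "z \<in> \<Union>?B" by (intro UnionI[of "box a b"]) (auto intro!: image_eqI[of _ _ "(a, b)"])
  qed
  moreover have "AE z in lborel. \<forall>C\<in>\<D>. z \<in> C \<longrightarrow> g z = 0"
    using D(1) loc by (intro AE_ball_countable'[OF _ D(2)]) auto
  ultimately show ?thesis using D(3) by (auto elim!: eventually_mono)
qed

lemma weak_deriv_unique:
  assumes "open \<Omega>" "has_weak_deriv \<Omega> e v g" "has_weak_deriv \<Omega> e v h"
  shows "AE z in lborel. z \<in> \<Omega> \<longrightarrow> g z = h z"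
proof -
  have int: "set_integrable lborel K g" "set_integrable lborel K h" if "compact K" "K \<subseteq> \<Omega>" for K
    using assms(2,3) that unfolding has_weak_deriv_def by auto
  have "AE z in lborel. z \<in> \<Omega> \<longrightarrow> g z - h z = 0"
  proof (rule AE_zero_if_orthogonal_to_test_funs[OF \<open>open \<Omega>\<close>])
    fix \<phi> assume \<phi>: "\<phi> \<in> test_funs \<Omega>"
    obtain K where K: "compact K" "K \<subseteq> \<Omega>" "\<And>z. z \<notin> K \<Longrightarrow> \<phi> z = 0"
      using test_fun_support[OF \<phi>] by metis
    obtain B where B: "0 \<le> B" "\<And>z. \<bar>\<phi> z\<bar> \<le> B" using test_fun_bounded[OF \<phi>] by metis
    have i: "set_integrable lborel \<Omega> (\<lambda>z. k z * \<phi> z)" if k: "set_integrable lborel K k" for k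
    proof -
      have k': "integrable lborel (\<lambda>z. indicator K z * k z)" using k by (simp add: set_integrable_def)
      have "integrable lborel (\<lambda>z. (indicator K z * k z) * \<phi> z)"
        using B test_fun_measurable(1)[OF \<phi>] borel_measurable_integrable[OF k']
        by (intro Bochner_Integration.integrable_bound[OF integrable_mult_right[OF integrable_abs[OF k'], of B]])
           (auto simp: abs_mult mult.commute intro!: AE_I2 mult_right_mono)
      also have "(\<lambda>z. (indicator K z * k z) * \<phi> z) = (\<lambda>z. indicator \<Omega> z *\<^sub>R (k z * \<phi> z))"
        using K(2,3) by (auto simp: fun_eq_iff indicator_def)
      finally show ?thesis by (simp add: set_integrable_def)
    qed
    have "(LINT z:\<Omega>|lborel. g z * \<phi> z) = (LINT z:\<Omega>|lborel. h z * \<phi> z)"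
      using bspec[OF conjunct2[OF assms(2)[unfolded has_weak_deriv_def]] \<phi>]
        bspec[OF conjunct2[OF assms(3)[unfolded has_weak_deriv_def]] \<phi>] by simp
    then show "(LINT z:\<Omega>|lborel. (g z - h z) * \<phi> z) = 0"
      using i[OF int(1)[OF K(1,2)]] i[OF int(2)[OF K(1,2)]] by (simp add: left_diff_distrib)
  qed (use int in \<open>auto intro: set_integral_diff\<close>)
  then show ?thesis by simp
qed

lemma weak_deriv_eq:
  assumes "open \<Omega>" "has_weak_deriv \<Omega> e v g"
  shows "has_weak_deriv \<Omega> e v (weak_deriv \<Omega> e v)"
    and "AE z in lborel. z \<in> \<Omega> \<longrightarrow> weak_deriv \<Omega> e v z = g z"
proof -
  show *: "has_weak_deriv \<Omega> e v (weak_deriv \<Omega> e v)"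
    unfolding weak_deriv_def by (rule someI[of _ g]) fact
  show "AE z in lborel. z \<in> \<Omega> \<longrightarrow> weak_deriv \<Omega> e v z = g z"
    by (rule weak_deriv_unique[OF assms(1) * assms(2)])
qed

lemma has_weak_deriv_measurable:
  assumes "open \<Omega>" "has_weak_deriv \<Omega> e v g"
  shows "set_borel_measurable lborel \<Omega> v" "set_borel_measurable lborel \<Omega> g"
  by (rule locally_integrable_measurable[OF assms(1)], use assms(2) in \<open>simp add: has_weak_deriv_def\<close>)+

text \<open>
  The chosen representative of a weak derivative can be replaced by any other one. The equality also
  covers functions that are not integrable, for which both sides are zero by convention; this is where
  measurability of both representatives matters.
\<close>

lemma weak_deriv_powr_integral:
  assumes "open \<Omega>" "has_weak_deriv \<Omega> e v g"
  shows "(LINT z:\<Omega>|lborel. \<bar>weak_deriv \<Omega> e v z\<bar> powr p) = (LINT z:\<Omega>|lborel. \<bar>g z\<bar> powr p)"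
  unfolding set_lebesgue_integral_def
proof (rule integral_cong_AE)
  have m: "(\<lambda>z. indicator \<Omega> z *\<^sub>R \<bar>k z\<bar> powr p) \<in> borel_measurable lborel"
    if "set_borel_measurable lborel \<Omega> k" for k :: plane_fun
  proof -
    have [measurable]: "(\<lambda>z. indicator \<Omega> z *\<^sub>R k z) \<in> borel_measurable borel" "\<Omega> \<in> sets borel"
      using that assms(1) by (auto simp: set_borel_measurable_def)
    have "(\<lambda>z. indicator \<Omega> z *\<^sub>R \<bar>indicator \<Omega> z *\<^sub>R k z\<bar> powr p) \<in> borel_measurable lborel"
      by measurable
    also have "(\<lambda>z. indicator \<Omega> z *\<^sub>R \<bar>indicator \<Omega> z *\<^sub>R k z\<bar> powr p) = (\<lambda>z. indicator \<Omega> z *\<^sub>R \<bar>k z\<bar> powr p)"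
      by (auto simp: indicator_def)
    finally show ?thesis .
  qed
  show "(\<lambda>z. indicator \<Omega> z *\<^sub>R \<bar>weak_deriv \<Omega> e v z\<bar> powr p) \<in> borel_measurable lborel"
    "(\<lambda>z. indicator \<Omega> z *\<^sub>R \<bar>g z\<bar> powr p) \<in> borel_measurable lborel"
    using m has_weak_deriv_measurable[OF assms(1)] assms(2) weak_deriv_eq(1)[OF assms] by blast+
qed (use weak_deriv_eq(2)[OF assms] in \<open>auto elim!: eventually_mono simp: indicator_def\<close>)

lemma has_weak_deriv_scale:
  assumes "has_weak_deriv \<Omega> e v g"
  shows "has_weak_deriv \<Omega> e (\<lambda>z. t * v z) (\<lambda>z. t * g z)"
proof -
  have "(LINT z:\<Omega>|lborel. t * (v z * frechet_derivative \<phi> (at z) e)) =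
      - (LINT z:\<Omega>|lborel. t * (g z * \<phi> z))" if "\<phi> \<in> test_funs \<Omega>" for \<phi>
    using assms that unfolding has_weak_deriv_def by simp
  then show ?thesis
    using assms unfolding has_weak_deriv_def by (simp add: mult.assoc)
qed

lemma W1_weak_deriv:
  assumes "open \<Omega>" "v \<in> W1 \<Omega> p" "e \<in> Basis"
  shows "has_weak_deriv \<Omega> e v (weak_deriv \<Omega> e v)"
  using assms weak_deriv_eq(1) unfolding W1_def by blast

lemma W1_seminorm_scale:
  assumes "open \<Omega>" "v \<in> W1 \<Omega> p" "p > 0"
  shows "W1_seminorm \<Omega> p (\<lambda>z. t * v z) = \<bar>t\<bar> * W1_seminorm \<Omega> p v"
proof -
  have "(LINT z:\<Omega>|lborel. \<bar>weak_deriv \<Omega> e (\<lambda>z. t * v z) z\<bar> powr p) =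
      \<bar>t\<bar> powr p * (LINT z:\<Omega>|lborel. \<bar>weak_deriv \<Omega> e v z\<bar> powr p)" if "e \<in> Basis" for e
    using weak_deriv_powr_integral[OF assms(1) has_weak_deriv_scale[OF W1_weak_deriv[OF assms(1,2) that]]]
    by (simp add: abs_mult powr_mult)
  then have "W1_seminorm \<Omega> p (\<lambda>z. t * v z) =
      (\<bar>t\<bar> powr p * (\<Sum>e\<in>Basis. LINT z:\<Omega>|lborel. \<bar>weak_deriv \<Omega> e v z\<bar> powr p)) powr (1 / p)"
    unfolding W1_seminorm_def by (simp add: sum_distrib_left)
  also have "\<dots> = \<bar>t\<bar> * W1_seminorm \<Omega> p v"
    using assms(3) unfolding W1_seminorm_def
    by (subst powr_mult) (auto simp: powr_powr intro!: sum_nonneg simp: set_lebesgue_integral_def)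
  finally show ?thesis .
qed

section \<open>Bounded limits of test functions\<close>

lemma bounded_set_integrable:
  fixes h :: "'a::euclidean_space \<Rightarrow> real"
  assumes [measurable]: "h \<in> borel_measurable borel" "S \<in> sets borel"
    and "bounded S" "\<And>z. \<bar>h z\<bar> \<le> B"
  shows "set_integrable lborel S h"
proof -
  have "integrable lborel (\<lambda>z. B * indicator S z)"
    using emeasure_bounded_finite[OF assms(3)] by (intro integrable_mult_right integrable_real_indicator) auto
  then show ?thesis
    unfolding set_integrable_def
    by (rule Bochner_Integration.integrable_bound)
       (auto intro!: AE_I2 order_trans[OF assms(4) abs_ge_self] simp: indicator_def)
qed

lemma bounded_set_convergence:
  fixes h :: "'a::euclidean_space \<Rightarrow> real"
  assumes [measurable]: "\<And>n. s n \<in> borel_measurable borel" "h \<in> borel_measurable borel" "S \<in> sets borel"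
    and S: "bounded S" and B: "\<And>n z. \<bar>s n z\<bar> \<le> B" and lim: "\<And>z. (\<lambda>n. s n z) \<longlonglongrightarrow> h z"
  shows "(\<lambda>n. LINT z:S|lborel. s n z) \<longlonglongrightarrow> (LINT z:S|lborel. h z)"
  unfolding set_lebesgue_integral_def
proof (rule integral_dominated_convergence[where w = "\<lambda>z. B * indicator S z"])
  show "integrable lborel (\<lambda>z. B * indicator S z)"
    using emeasure_bounded_finite[OF S] by (intro integrable_mult_right integrable_real_indicator) auto
qed (use lim B in \<open>auto intro!: AE_I2 tendsto_intros simp: indicator_def\<close>)

text \<open>
  Pointwise limits of test functions whose values and first derivatives are uniformly bounded. On a
  bounded domain every integral below converges by dominated convergence, so such limits lie in
  \<open>W1_zero \<Omega> p\<close> for all \<open>p > 0\<close> at once, with the pointwise limits \<open>g\<close> of the derivatives as weak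
  derivatives.
\<close>

locale bounded_test_limit =
  fixes \<Omega> :: "(real \<times> real) set" and \<phi> :: "nat \<Rightarrow> plane_fun" and v :: plane_fun
    and g :: "real \<times> real \<Rightarrow> plane_fun" and B :: real
  assumes \<Omega>: "open \<Omega>" "bounded \<Omega>"
    and test: "\<And>n. \<phi> n \<in> test_funs \<Omega>"
    and bound: "\<And>n z. \<bar>\<phi> n z\<bar> \<le> B"
    and bound': "\<And>n e z. e \<in> Basis \<Longrightarrow> \<bar>frechet_derivative (\<phi> n) (at z) e\<bar> \<le> B"
    and lim: "\<And>z. (\<lambda>n. \<phi> n z) \<longlonglongrightarrow> v z"
    and lim': "\<And>e z. e \<in> Basis \<Longrightarrow> (\<lambda>n. frechet_derivative (\<phi> n) (at z) e) \<longlonglongrightarrow> g e z"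
begin

lemma meas [measurable]:
  shows "\<phi> n \<in> borel_measurable borel" "(\<lambda>z. frechet_derivative (\<phi> n) (at z) e) \<in> borel_measurable borel"
    "v \<in> borel_measurable borel" "\<Omega> \<in> sets borel"
  using test_fun_measurable[OF test] \<Omega>(1)
  by (auto intro: borel_measurable_LIMSEQ_metric[OF _ lim])

lemma meas' [measurable]: "e \<in> Basis \<Longrightarrow> g e \<in> borel_measurable borel"
  by (rule borel_measurable_LIMSEQ_metric[OF meas(2) lim'])

lemma limit_bound: "\<bar>v z\<bar> \<le> B" "e \<in> Basis \<Longrightarrow> \<bar>g e z\<bar> \<le> B"
  using LIMSEQ_le_const2[OF tendsto_rabs[OF lim]] LIMSEQ_le_const2[OF tendsto_rabs[OF lim']] bound bound'
  by blast+

lemma weak_deriv_limit: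
  assumes e: "e \<in> Basis"
  shows "has_weak_deriv \<Omega> e v (g e)"
  unfolding has_weak_deriv_def
proof (intro conjI allI impI ballI)
  fix K :: "(real \<times> real) set" assume K: "compact K \<and> K \<subseteq> \<Omega>"
  then have K': "K \<in> sets borel" "bounded K" by (auto intro: borel_compact compact_imp_bounded)
  show "set_integrable lborel K v"
    by (rule bounded_set_integrable[OF meas(3) K' limit_bound(1)])
  show "set_integrable lborel K (g e)"
    by (rule bounded_set_integrable[OF meas'[OF e] K' limit_bound(2)[OF e]])
next
  fix \<psi> assume \<psi>: "\<psi> \<in> test_funs \<Omega>"
  note [measurable] = test_fun_measurable[OF \<psi>] meas'[OF e]
  obtain C where C: "0 \<le> C" "\<And>z. \<bar>\<psi> z\<bar> \<le> C" "\<And>z. \<bar>frechet_derivative \<psi> (at z) e\<bar> \<le> C"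
    using test_fun_bounded[OF \<psi>, of e] by metis
  have B0: "0 \<le> B" using bound[of 0 0] by linarith
  have l1: "(\<lambda>n. LINT z:\<Omega>|lborel. \<phi> n z * frechet_derivative \<psi> (at z) e) \<longlonglongrightarrow>
      (LINT z:\<Omega>|lborel. v z * frechet_derivative \<psi> (at z) e)"
    using C bound B0
    by (intro bounded_set_convergence[where B = "B * C"] \<Omega> tendsto_intros lim)
       (auto simp: abs_mult intro!: mult_mono)
  have l2: "(\<lambda>n. LINT z:\<Omega>|lborel. frechet_derivative (\<phi> n) (at z) e * \<psi> z) \<longlonglongrightarrow>
      (LINT z:\<Omega>|lborel. g e z * \<psi> z)"
    using C bound'[OF e] B0
    by (intro bounded_set_convergence[where B = "B * C"] \<Omega> tendsto_intros lim' e)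
       (auto simp: abs_mult intro!: mult_mono)
  have l3: "(LINT z:\<Omega>|lborel. \<phi> n z * frechet_derivative \<psi> (at z) e) =
      - (LINT z:\<Omega>|lborel. frechet_derivative (\<phi> n) (at z) e * \<psi> z)" for n
    using test_fun_has_weak_deriv[OF test[of n], of e] \<psi> unfolding has_weak_deriv_def by blast
  show "(LINT z:\<Omega>|lborel. v z * frechet_derivative \<psi> (at z) e) = - (LINT z:\<Omega>|lborel. g e z * \<psi> z)"
    using LIMSEQ_unique[OF l1] tendsto_minus[OF l2] by (simp add: l3)
qed

lemma weak_deriv_difference:
  assumes e: "e \<in> Basis"
  shows "has_weak_deriv \<Omega> e (\<phi> n - v) (\<lambda>z. frechet_derivative (\<phi> n) (at z) e - g e z)"
  unfolding has_weak_deriv_def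
proof (intro conjI allI impI ballI)
  fix K :: "(real \<times> real) set" assume K: "compact K \<and> K \<subseteq> \<Omega>"
  then show "set_integrable lborel K (\<phi> n - v)"
      "set_integrable lborel K (\<lambda>z. frechet_derivative (\<phi> n) (at z) e - g e z)"
    using test_fun_has_weak_deriv[OF test[of n], of e] weak_deriv_limit[OF e]
    unfolding has_weak_deriv_def fun_diff_def by (auto intro!: set_integral_diff)
next
  fix \<psi> assume \<psi>: "\<psi> \<in> test_funs \<Omega>"
  note [measurable] = test_fun_measurable[OF \<psi>] meas'[OF e]
  obtain C where C: "0 \<le> C" "\<And>z. \<bar>\<psi> z\<bar> \<le> C" "\<And>z. \<bar>frechet_derivative \<psi> (at z) e\<bar> \<le> C"
    using test_fun_bounded[OF \<psi>, of e] by metis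
  have B0: "0 \<le> B" using bound[of 0 0] by linarith
  have int: "set_integrable lborel \<Omega> (\<lambda>z. h z * k z)"
    if [measurable]: "h \<in> borel_measurable borel" "k \<in> borel_measurable borel"
      and "\<And>z. \<bar>h z\<bar> \<le> B" "\<And>z. \<bar>k z\<bar> \<le> C" for h k :: plane_fun
    using that B0 C(1)
    by (intro bounded_set_integrable[where B = "B * C"] \<Omega>) (auto simp: abs_mult intro!: mult_mono)
  have "(LINT z:\<Omega>|lborel. (\<phi> n z - v z) * frechet_derivative \<psi> (at z) e) =
      (LINT z:\<Omega>|lborel. \<phi> n z * frechet_derivative \<psi> (at z) e) -
      (LINT z:\<Omega>|lborel. v z * frechet_derivative \<psi> (at z) e)"
    unfolding left_diff_distrib by (intro set_integral_diff int bound limit_bound C) measurable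
  also have "\<dots> = - ((LINT z:\<Omega>|lborel. frechet_derivative (\<phi> n) (at z) e * \<psi> z) - (LINT z:\<Omega>|lborel. g e z * \<psi> z))"
    using test_fun_has_weak_deriv[OF test[of n], of e] weak_deriv_limit[OF e] \<psi>
    unfolding has_weak_deriv_def by simp
  also have "\<dots> = - (LINT z:\<Omega>|lborel. (frechet_derivative (\<phi> n) (at z) e - g e z) * \<psi> z)"
    unfolding left_diff_distrib
    by (subst set_integral_diff(2)) (auto intro!: int bound'[OF e] limit_bound e C)
  finally show "(LINT z:\<Omega>|lborel. (\<phi> n - v) z * frechet_derivative \<psi> (at z) e) =
      - (LINT z:\<Omega>|lborel. (frechet_derivative (\<phi> n) (at z) e - g e z) * \<psi> z)"
    by simp
qed

lemma limit_in_W1_zero: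
  assumes p: "p > 0"
  shows "v \<in> W1_zero \<Omega> p"
proof -
  have B0: "0 \<le> B" using bound[of 0 0] by linarith
  have Lp: "h \<in> Lp_space \<Omega> p" if [measurable]: "h \<in> borel_measurable borel" and h: "\<And>z. \<bar>h z\<bar> \<le> B" for h
  proof -
    have "set_integrable lborel \<Omega> (\<lambda>z. \<bar>h z\<bar> powr p)"
      using h p by (intro bounded_set_integrable[where B = "B powr p"] \<Omega>) (auto intro!: powr_mono2)
    then show ?thesis by (simp add: Lp_space_def set_borel_measurable_def)
  qed
  have "v \<in> W1 \<Omega> p"
    unfolding W1_def using Lp[OF meas(3) limit_bound(1)] Lp[OF meas' limit_bound(2)] weak_deriv_limit
    by blast
  moreover have "(\<lambda>n. W1_norm \<Omega> p (\<phi> n - v)) \<longlonglongrightarrow> 0"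
  proof -
    have null: "(\<lambda>n. LINT z:\<Omega>|lborel. \<bar>h n z - k z\<bar> powr p) \<longlonglongrightarrow> 0"
      if [measurable]: "\<And>n. h n \<in> borel_measurable borel" "k \<in> borel_measurable borel"
        and b: "\<And>n z. \<bar>h n z\<bar> \<le> B" "\<And>z. \<bar>k z\<bar> \<le> B" and l: "\<And>z. (\<lambda>n. h n z) \<longlonglongrightarrow> k z" for h k
    proof -
      have "(\<lambda>n. LINT z:\<Omega>|lborel. \<bar>h n z - k z\<bar> powr p) \<longlonglongrightarrow> (LINT z:\<Omega>|lborel. 0)"
      proof (rule bounded_set_convergence[where B = "(2 * B) powr p"])
        show "\<bar>\<bar>h n z - k z\<bar> powr p\<bar> \<le> (2 * B) powr p" for n z
          using b(1)[of n z] b(2)[of z] p by (auto intro!: powr_mono2)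
        show "(\<lambda>n. \<bar>h n z - k z\<bar> powr p) \<longlonglongrightarrow> 0" for z
          using p by (intro tendsto_zero_powrI[OF _ tendsto_const]) (auto intro!: tendsto_rabs_zero LIM_zero l)
      qed (use \<Omega> in auto)
      then show ?thesis by (simp add: set_lebesgue_integral_def)
    qed
    have "(\<lambda>n. ((LINT z:\<Omega>|lborel. \<bar>\<phi> n z - v z\<bar> powr p) +
        (\<Sum>e\<in>Basis. LINT z:\<Omega>|lborel. \<bar>frechet_derivative (\<phi> n) (at z) e - g e z\<bar> powr p))) \<longlonglongrightarrow>
        0 + (\<Sum>e\<in>(Basis :: (real \<times> real) set). 0)"
      by (intro tendsto_add tendsto_sum null) (auto simp: bound bound' limit_bound lim lim')
    then have "(\<lambda>n. ((LINT z:\<Omega>|lborel. \<bar>\<phi> n z - v z\<bar> powr p) +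
        (\<Sum>e\<in>Basis. LINT z:\<Omega>|lborel. \<bar>frechet_derivative (\<phi> n) (at z) e - g e z\<bar> powr p)) powr (1 / p)) \<longlonglongrightarrow> 0"
      using p by (intro tendsto_zero_powrI[OF _ tendsto_const])
        (auto intro!: always_eventually add_nonneg_nonneg sum_nonneg simp: set_lebesgue_integral_def)
    then show ?thesis
      unfolding W1_norm_def by (simp add: weak_deriv_powr_integral[OF \<Omega>(1) weak_deriv_difference])
  qed
  ultimately show ?thesis unfolding W1_zero_def using test by blast
qed

end

section \<open>Flattening the line near mesh nodes\<close>

text \<open>
  The map \<open>t \<mapsto> t + kink t = t * smooth_step (t\<^sup>2 - 1)\<close> is constant for \<open>\<bar>t\<bar> \<le> 1\<close>, the identity for
  \<open>\<bar>t\<bar> \<ge> 2\<close>, and moves every point towards \<open>0\<close>. So \<open>kink\<close> is the compactly supported correction that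
  flattens the identity at the origin.
\<close>

definition kink :: "real \<Rightarrow> real" where
  "kink t = t * (smooth_step (t\<^sup>2 - 1) - 1)"

lemma smooth1_kink: "smooth1 kink"
  unfolding kink_def[abs_def]
  by (intro smooth1_mult smooth1_diff smooth1_compose[OF smooth1_step] smooth1_intros)

lemma kink_far: "2 \<le> \<bar>t\<bar> \<Longrightarrow> kink t = 0"
proof -
  assume "2 \<le> \<bar>t\<bar>"
  then have "2\<^sup>2 \<le> \<bar>t\<bar>\<^sup>2" by (intro power_mono) auto
  then show ?thesis by (simp add: kink_def smooth_step_1)
qed

lemma kink_near: "\<bar>t\<bar> \<le> 1 \<Longrightarrow> kink t = - t"
proof -
  assume "\<bar>t\<bar> \<le> 1"
  then have "\<bar>t\<bar>\<^sup>2 \<le> 1\<^sup>2" by (intro power_mono) auto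
  then show ?thesis by (simp add: kink_def smooth_step_0)
qed

lemma deriv_kink_bounded: obtains B where "0 \<le> B" "\<And>t. \<bar>deriv kink t\<bar> \<le> B"
proof (rule continuous_compact_support_bounded[of "deriv kink" "{-2..2}"])
  show "continuous_on UNIV (deriv kink)"
    by (intro smooth1_continuous_on smooth1_deriv smooth1_kink)
  show "deriv kink t = 0" if "t \<notin> {-2..2}" for t
  proof -
    have "open (- {-2..2 :: real})" by auto
    from eventually_nhds_in_open[OF this] that have "\<forall>\<^sub>F s in nhds t. s \<in> - {-2..2}"
      by blast
    then have "\<forall>\<^sub>F s in nhds t. kink s = 0"
      by eventually_elim (auto intro!: kink_far)
    then have "deriv kink t = deriv (\<lambda>_. 0) t" by (intro deriv_cong_ev) auto
    then show ?thesis by simp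
  qed
qed auto

text \<open>
  The kinks are scaled by \<open>1 / n\<close> in both directions: their supports shrink to the nodes in \<open>Z\<close> while
  their slopes stay bounded.
\<close>

definition flatten :: "real set \<Rightarrow> nat \<Rightarrow> real \<Rightarrow> real" where
  "flatten Z n x = x + (\<Sum>z\<in>Z. kink (real n * (x - z)) / real n)"

text \<open>
  A scaled kink has a support of radius \<open>2 / n\<close>, so at distance \<open>4 / n\<close> different nodes do not interfere.
\<close>

definition separated :: "real set \<Rightarrow> nat \<Rightarrow> bool" where
  "separated Z n \<longleftrightarrow> n > 0 \<and> (\<forall>z\<in>Z. \<forall>z'\<in>Z. z \<noteq> z' \<longrightarrow> 4 \<le> real n * \<bar>z - z'\<bar>)"

lemma eventually_separated:
  assumes "finite Z"
  shows "\<forall>\<^sub>F n in sequentially. separated Z n"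
proof -
  have "\<forall>\<^sub>F n in sequentially. z \<noteq> z' \<longrightarrow> 4 \<le> real n * \<bar>z - z'\<bar>" for z z' :: real
    using eventually_ge_linear[of "\<bar>z - z'\<bar>" 4] by (cases "z = z'") auto
  then have "\<forall>\<^sub>F n in sequentially. \<forall>z\<in>Z. \<forall>z'\<in>Z. z \<noteq> z' \<longrightarrow> 4 \<le> real n * \<bar>z - z'\<bar>"
    using assms by (intro eventually_ball_finite ballI) auto
  with eventually_gt_at_top[of 0] show ?thesis
    unfolding separated_def by eventually_elim auto
qed

lemma smooth1_flatten: "smooth1 (flatten Z n)"
  unfolding flatten_def[abs_def] divide_inverse
  by (intro smooth1_intros smooth1_compose[OF smooth1_kink])

lemma deriv_flatten:
  assumes "n > 0"
  shows "deriv (flatten Z n) x = 1 + (\<Sum>z\<in>Z. deriv kink (real n * (x - z)))"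
proof (rule DERIV_imp_deriv)
  have "((\<lambda>x. kink (real n * (x - z)) / real n) has_real_derivative deriv kink (real n * (x - z))) (at x)" for z
  proof -
    have "((\<lambda>x. kink (real n * (x - z))) has_real_derivative deriv kink (real n * (x - z)) * real n) (at x)"
      by (rule DERIV_chain2[OF smooth1_deriv(1)[OF smooth1_kink]]) (auto intro!: derivative_eq_intros)
    from DERIV_cdivide[OF this, of "real n"] show ?thesis using assms by simp
  qed
  then show "(flatten Z n has_real_derivative 1 + (\<Sum>z\<in>Z. deriv kink (real n * (x - z)))) (at x)"
    unfolding flatten_def[abs_def] by (intro DERIV_add DERIV_ident DERIV_sum)
qed

lemma deriv_flatten_bounded:
  obtains B where "\<And>n x. n > 0 \<Longrightarrow> \<bar>deriv (flatten Z n) x\<bar> \<le> B"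
proof -
  obtain C where C: "0 \<le> C" "\<And>t. \<bar>deriv kink t\<bar> \<le> C" using deriv_kink_bounded by metis
  have "\<bar>deriv (flatten Z n) x\<bar> \<le> 1 + (\<Sum>z\<in>Z. C)" if "n > 0" for n x
  proof -
    have "\<bar>\<Sum>z\<in>Z. deriv kink (real n * (x - z))\<bar> \<le> (\<Sum>z\<in>Z. C)"
      using C by (intro order_trans[OF sum_abs] sum_mono) auto
    then show ?thesis unfolding deriv_flatten[OF that] by linarith
  qed
  then show ?thesis using that by blast
qed

lemma flatten_near_node:
  assumes "finite Z" "separated Z n" "z \<in> Z" "real n * \<bar>x - z\<bar> < 2"
  shows "flatten Z n x = x + kink (real n * (x - z)) / real n"
proof -
  have "kink (real n * (x - z')) = 0" if "z' \<in> Z - {z}" for z'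
  proof (rule kink_far)
    have "4 \<le> real n * \<bar>z - z'\<bar>" using assms(2,3) that unfolding separated_def by auto
    also have "\<dots> \<le> real n * (\<bar>x - z\<bar> + \<bar>x - z'\<bar>)" by (intro mult_left_mono) auto
    finally show "2 \<le> \<bar>real n * (x - z')\<bar>" using assms(4) by (simp add: abs_mult distrib_left)
  qed
  then show ?thesis
    unfolding flatten_def using assms(1,3) by (simp add: sum.remove[of Z z])
qed

lemma flatten_at_node:
  assumes "finite Z" "separated Z n" "z \<in> Z" "real n * \<bar>x - z\<bar> \<le> 1"
  shows "flatten Z n x = z"
proof -
  have "kink (real n * (x - z)) = - (real n * (x - z))"
    using assms(4) by (intro kink_near) (simp add: abs_mult)
  then show ?thesis
    using flatten_near_node[of Z n z x] assms by (simp add: separated_def field_simps)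
qed

lemma flatten_away:
  assumes "\<And>z. z \<in> Z \<Longrightarrow> 2 \<le> real n * \<bar>x - z\<bar>"
  shows "flatten Z n x = x"
proof -
  have "kink (real n * (x - z)) = 0" if "z \<in> Z" for z
    using assms[OF that] by (intro kink_far) (simp add: abs_mult)
  then show ?thesis by (simp add: flatten_def)
qed

text \<open>
  The last clause says that a node outside \<open>C\<close> is screened off from any point of \<open>C\<close> by a node inside
  \<open>C\<close> that is at least as close. It holds for the intervals between consecutive nodes and for the two
  unbounded intervals beyond the end nodes.
\<close>

definition cell :: "real set \<Rightarrow> real set \<Rightarrow> bool" where
  "cell Z C \<longleftrightarrow> convex C \<and> C - Z \<subseteq> interior C \<and>
     (\<forall>x\<in>C. \<forall>z\<in>Z - C. \<exists>z'\<in>Z \<inter> C. \<bar>x - z'\<bar> \<le> \<bar>x - z\<bar>)"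

text \<open>
  A point that is moved at all is moved along the segment towards the only node nearby. That node lies
  in \<open>C\<close>, since otherwise a second node would be nearby too; so the convex set \<open>C\<close> contains the segment.
\<close>

lemma flatten_cell:
  assumes Z: "finite Z" "separated Z n" and C: "cell Z C" and x: "x \<in> C"
  shows "flatten Z n x \<in> C"
proof (cases "\<exists>z\<in>Z. real n * \<bar>x - z\<bar> < 2")
  case True
  then obtain z where z: "z \<in> Z" "real n * \<bar>x - z\<bar> < 2" by blast
  have n: "real n > 0" using Z(2) by (simp add: separated_def)
  have "z \<in> C"
  proof (rule ccontr)
    assume "z \<notin> C"
    then obtain z' where z': "z' \<in> Z" "z' \<in> C" "\<bar>x - z'\<bar> \<le> \<bar>x - z\<bar>"
      using C x z(1) unfolding cell_def by blast
    have "4 \<le> real n * \<bar>z - z'\<bar>"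
      using Z(2) z(1) z' \<open>z \<notin> C\<close> unfolding separated_def by auto
    also have "\<dots> \<le> real n * (\<bar>x - z\<bar> + \<bar>x - z\<bar>)" by (intro mult_left_mono) (use z'(3) in linarith, simp)
    finally show False using z(2) by simp
  qed
  define \<theta> where "\<theta> = smooth_step ((real n * (x - z))\<^sup>2 - 1)"
  have "kink (real n * (x - z)) / real n = (x - z) * (\<theta> - 1)"
    using n by (simp add: kink_def \<theta>_def)
  then have "flatten Z n x = (1 - \<theta>) *\<^sub>R z + \<theta> *\<^sub>R x"
    using flatten_near_node[OF Z z] by (simp add: algebra_simps)
  moreover have "(1 - \<theta>) *\<^sub>R z + \<theta> *\<^sub>R x \<in> C"
    using C \<open>z \<in> C\<close> x smooth_step_range unfolding cell_def \<theta>_def by (intro convexD_alt) auto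
  ultimately show ?thesis by simp
qed (use x flatten_away in \<open>force simp: not_less\<close>)

text \<open>
  In the interior of \<open>C\<close> this is \<open>flatten_cell\<close>. At a node, \<open>flatten Z n\<close> is constant nearby, so that a
  whole neighbourhood, including points of other cells, is mapped to the node.
\<close>

lemma flatten_locally_in_cell:
  assumes Z: "finite Z" "separated Z n" and C: "cell Z C" and x: "x \<in> C"
  obtains U where "open U" "x \<in> U" "\<And>t. t \<in> U \<Longrightarrow> flatten Z n t \<in> C"
proof (cases "x \<in> Z")
  case True
  have n: "real n > 0" using Z(2) by (simp add: separated_def)
  show ?thesis
  proof (rule that)
    show "open (ball x (1 / real n))" "x \<in> ball x (1 / real n)" using n by auto
    show "flatten Z n t \<in> C" if "t \<in> ball x (1 / real n)" for t
    proof -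
      have "\<bar>t - x\<bar> < 1 / real n" using that by (simp add: dist_real_def abs_minus_commute)
      then have "real n * \<bar>t - x\<bar> \<le> 1" using n by (simp add: field_simps)
      then show ?thesis using flatten_at_node[OF Z True] x by simp
    qed
  qed
next
  case False
  then show ?thesis
    using C x flatten_cell[OF Z C] interior_subset[of C]
    by (intro that[of "interior C"]) (auto simp: cell_def)
qed

text \<open>
  For fixed \<open>x\<close> nothing changes for large \<open>n\<close>: near a node \<open>flatten Z n\<close> is constant, and near any
  other point it is the identity. Hence the derivative converges at nodes as well, to \<open>0\<close>.
\<close>

lemma flatten_eventually:
  assumes Z: "finite Z"
  shows "\<forall>\<^sub>F n in sequentially. flatten Z n x = x"
    and "\<forall>\<^sub>F n in sequentially. deriv (flatten Z n) x = (if x \<in> Z then 0 else 1)"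
proof -
  have 1: "\<forall>\<^sub>F n in sequentially. flatten Z n x = x \<and> deriv (flatten Z n) x = (if x \<in> Z then 0 else 1)"
  proof (cases "x \<in> Z")
    case True
    from eventually_separated[OF Z] show ?thesis
    proof eventually_elim
      case (elim n)
      have n: "real n > 0" using elim by (simp add: separated_def)
      have "\<forall>\<^sub>F t in nhds x. flatten Z n t = x"
        using eventually_nhds_in_open[of "ball x (1 / real n)" x] n
        by (auto elim!: eventually_mono intro!: flatten_at_node[OF Z elim True]
            simp: dist_real_def abs_minus_commute field_simps)
      then have "deriv (flatten Z n) x = deriv (\<lambda>_. x) x" by (intro deriv_cong_ev) auto
      then show ?case using flatten_at_node[OF Z elim True, of x] True by simp
    qed
  next
    case False
    have "\<forall>\<^sub>F n in sequentially. \<forall>z\<in>Z. 3 \<le> real n * \<bar>x - z\<bar>"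
      using False by (intro eventually_ball_finite[OF Z] ballI eventually_ge_linear) auto
    with eventually_gt_at_top[of 0] show ?thesis
    proof eventually_elim
      case (elim n)
      have far: "flatten Z n t = t" if "t \<in> ball x (1 / real n)" for t
      proof (rule flatten_away)
        fix z assume "z \<in> Z"
        have "real n * \<bar>x - t\<bar> \<le> 1" using that elim(1) by (simp add: dist_real_def field_simps)
        moreover have "real n * \<bar>x - z\<bar> \<le> real n * (\<bar>x - t\<bar> + \<bar>t - z\<bar>)"
          by (intro mult_left_mono) auto
        moreover have "3 \<le> real n * \<bar>x - z\<bar>"
          using elim(2) \<open>z \<in> Z\<close> by blast
        ultimately show "2 \<le> real n * \<bar>t - z\<bar>" by (simp add: distrib_left)
      qed
      then have "\<forall>\<^sub>F t in nhds x. flatten Z n t = t"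
        using eventually_nhds_in_open[of "ball x (1 / real n)" x] elim(1)
        by (auto elim!: eventually_mono)
      then have "deriv (flatten Z n) x = deriv (\<lambda>t. t) x" by (intro deriv_cong_ev) auto
      then show ?case using far[of x] elim(1) False by simp
    qed
  qed
  show "\<forall>\<^sub>F n in sequentially. flatten Z n x = x"
    and "\<forall>\<^sub>F n in sequentially. deriv (flatten Z n) x = (if x \<in> Z then 0 else 1)"
    using 1 by (auto elim: eventually_mono)
qed

section \<open>Finite element functions in Sobolev spaces\<close>

text \<open>
  The two unbounded intervals are included so that the cells cover the line, and finite element
  functions, extended by zero, are polynomial on every product of two cells.
\<close>

definition mesh_cells :: "nat \<Rightarrow> (nat \<Rightarrow> real) \<Rightarrow> real set set" where
  "mesh_cells N \<xi> = insert {..\<xi> 0} (insert {\<xi> N..} ((\<lambda>i. {\<xi> i..\<xi> (Suc i)}) ` {..<N}))"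

lemma interval_nodes_mono:
  assumes "interval_nodes a b N \<xi>" "i \<le> j" "j \<le> N"
  shows "\<xi> i \<le> \<xi> j"
  using assms(2,3)
proof (induction j rule: dec_induct)
  case (step j)
  then have "\<xi> j < \<xi> (Suc j)" using assms(1) by (auto simp: interval_nodes_def)
  with step show ?case by auto
qed simp

lemma mesh_cells_cell:
  assumes nodes: "interval_nodes a b N \<xi>" and C: "C \<in> mesh_cells N \<xi>"
  shows "cell (\<xi> ` {..N}) C"
proof -
  note mono = interval_nodes_mono[OF nodes]
  consider "C = {..\<xi> 0}" | "C = {\<xi> N..}" | i where "i < N" "C = {\<xi> i..\<xi> (Suc i)}"
    using C by (auto simp: mesh_cells_def)
  then show ?thesis
  proof cases
    case 1
    have "\<exists>z'\<in>\<xi> ` {..N} \<inter> C. \<bar>x - z'\<bar> \<le> \<bar>x - z\<bar>" if "x \<in> C" "z \<in> \<xi> ` {..N} - C" for x z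
      using that 1 by (intro bexI[of _ "\<xi> 0"]) auto
    then show ?thesis using 1 by (force simp: cell_def)
  next
    case 2
    have "\<exists>z'\<in>\<xi> ` {..N} \<inter> C. \<bar>x - z'\<bar> \<le> \<bar>x - z\<bar>" if "x \<in> C" "z \<in> \<xi> ` {..N} - C" for x z
      using that 2 by (intro bexI[of _ "\<xi> N"]) auto
    then show ?thesis using 2 by (force simp: cell_def)
  next
    case (3 i)
    have "\<exists>z'\<in>\<xi> ` {..N} \<inter> C. \<bar>x - z'\<bar> \<le> \<bar>x - z\<bar>" if xz: "x \<in> C" "z \<in> \<xi> ` {..N} - C" for x z
    proof -
      have "\<xi> i \<le> \<xi> (Suc i)" using mono[of i "Suc i"] 3(1) by simp
      consider "z < \<xi> i" | "z > \<xi> (Suc i)" using xz(2) 3(2) by fastforce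
      then show ?thesis
      proof cases
        case 1
        then show ?thesis using xz(1) 3 \<open>\<xi> i \<le> \<xi> (Suc i)\<close> by (intro bexI[of _ "\<xi> i"]) auto
      next
        case 2
        then show ?thesis using xz(1) 3 \<open>\<xi> i \<le> \<xi> (Suc i)\<close> by (intro bexI[of _ "\<xi> (Suc i)"]) auto
      qed
    qed
    moreover have "C - \<xi> ` {..N} \<subseteq> interior C"
    proof
      fix x assume x: "x \<in> C - \<xi> ` {..N}"
      have "\<xi> i \<in> \<xi> ` {..N}" "\<xi> (Suc i) \<in> \<xi> ` {..N}" using 3(1) by (intro imageI; simp)+
      with x have "x \<noteq> \<xi> i" "x \<noteq> \<xi> (Suc i)" by auto
      with x show "x \<in> interior C" using 3(2) by auto
    qed
    ultimately show ?thesis using 3 by (auto simp: cell_def)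
  qed
qed

lemma mesh_cells_cover: "\<exists>C\<in>mesh_cells N \<xi>. x \<in> C"
proof -
  have "\<xi> 0 \<le> x \<Longrightarrow> x < \<xi> k \<Longrightarrow> \<exists>i<k. x \<in> {\<xi> i..\<xi> (Suc i)}" for k
  proof (induction k)
    case (Suc k)
    then show ?case
    proof (cases "x < \<xi> k")
      case True
      with Suc obtain i where "i < k" "x \<in> {\<xi> i..\<xi> (Suc i)}" by blast
      then show ?thesis by (intro exI[of _ i]) auto
    next
      case False
      with Suc.prems show ?thesis by (intro exI[of _ k]) auto
    qed
  qed simp
  from this[of N] show ?thesis
    unfolding mesh_cells_def by (cases "\<xi> 0 \<le> x"; cases "x < \<xi> N") auto
qed

lemma fe_space_2d_outside:
  assumes "v \<in> fe_space_2d N \<xi> r M \<eta> s" "z \<notin> {\<xi> 0<..<\<xi> N} \<times> {\<eta> 0<..<\<eta> M}"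
  shows "v z = 0"
  using assms unfolding fe_space_2d_def by blast

text \<open>
  On unbounded products the polynomial is zero. This is recorded because it makes the derivatives of
  the polynomials bounded on their products of cells.
\<close>

lemma fe_space_2d_cell_poly:
  assumes v: "v \<in> fe_space_2d N \<xi> r M \<eta> s"
    and C: "C \<in> mesh_cells N \<xi>" and D: "D \<in> mesh_cells M \<eta>"
  shows "\<exists>c. (\<forall>x\<in>C. \<forall>y\<in>D. v (x, y) = (\<Sum>(a, b)\<in>{..r} \<times> {..s}. c a b * x ^ a * y ^ b)) \<and>
    (bounded C \<and> bounded D \<or> (\<forall>a b. c a b = 0))"
proof -
  have zero: "v z = 0" if "z \<notin> {\<xi> 0<..<\<xi> N} \<times> {\<eta> 0<..<\<eta> M}" for z
    by (rule fe_space_2d_outside[OF v that])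
  consider "C = {..\<xi> 0} \<or> C = {\<xi> N..} \<or> D = {..\<eta> 0} \<or> D = {\<eta> M..}" |
    i j where "i < N" "j < M" "C = {\<xi> i..\<xi> (Suc i)}" "D = {\<eta> j..\<eta> (Suc j)}"
    using C D unfolding mesh_cells_def by blast
  then show ?thesis
  proof cases
    case 1
    then have "\<forall>x\<in>C. \<forall>y\<in>D. v (x, y) = 0" by (auto intro!: zero)
    then show ?thesis by (intro exI[of _ "\<lambda>_ _. 0"]) simp
  next
    case (2 i j)
    then obtain c where "\<forall>x\<in>C. \<forall>y\<in>D. v (x, y) = (\<Sum>a\<le>r. \<Sum>b\<le>s. c a b * x ^ a * y ^ b)"
      using v unfolding fe_space_2d_def by blast
    then show ?thesis
      using 2 by (intro exI[of _ c]) (simp add: sum.cartesian_product)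
  qed
qed

lemma fe_space_2d_bounded:
  assumes "v \<in> fe_space_2d N \<xi> r M \<eta> s"
  obtains B where "\<And>z. \<bar>v z\<bar> \<le> B"
proof (rule continuous_compact_support_bounded[of v "cbox (\<xi> 0, \<eta> 0) (\<xi> N, \<eta> M)"])
  show "v z = 0" if "z \<notin> cbox (\<xi> 0, \<eta> 0) (\<xi> N, \<eta> M)" for z
  proof -
    have "z \<notin> {\<xi> 0<..<\<xi> N} \<times> {\<eta> 0<..<\<eta> M}" using that by (auto simp: cbox_Pair_eq)
    then show ?thesis by (rule fe_space_2d_outside[OF assms])
  qed
qed (use assms in \<open>auto simp: fe_space_2d_def\<close>)

lemma bounded_power_sum:
  fixes c :: "nat \<times> nat \<Rightarrow> real"
  assumes "bounded C" "bounded D" "finite L"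
  shows "bounded ((\<lambda>(x, y). \<Sum>l\<in>L. c l * x ^ i l * y ^ j l) ` (C \<times> D))"
proof -
  have "continuous_on (closure C \<times> closure D) (\<lambda>(x, y). \<Sum>l\<in>L. c l * x ^ i l * y ^ j l)"
    unfolding case_prod_beta by (intro continuous_intros)
  moreover have "compact (closure C \<times> closure D)"
    using assms(1,2) by (intro compact_Times) (auto simp: compact_closure)
  ultimately have "bounded ((\<lambda>(x, y). \<Sum>l\<in>L. c l * x ^ i l * y ^ j l) ` (closure C \<times> closure D))"
    by (intro compact_imp_bounded compact_continuous_image)
  then show ?thesis
    by (rule bounded_subset) (use closure_subset in \<open>blast intro: image_mono\<close>)
qed

text \<open>
  Together with its mirror image below, this pushes a boundary strip of width \<open>1 / n\<close> to or beyond the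
  boundary, which gives the approximants compact support in the open domain.
\<close>

lemma flatten_left:
  assumes nodes: "interval_nodes a b N \<xi>" and n: "separated (\<xi> ` {..N}) n"
    and x: "x < \<xi> 0 + 1 / real n"
  shows "flatten (\<xi> ` {..N}) n x \<le> \<xi> 0"
proof (cases "x \<le> \<xi> 0")
  case True
  have "cell (\<xi> ` {..N}) {..\<xi> 0}"
    by (rule mesh_cells_cell[OF nodes]) (simp add: mesh_cells_def)
  from flatten_cell[OF _ n this, of x] True show ?thesis by simp
next
  case False
  have "real n > 0" using n by (simp add: separated_def)
  then have "flatten (\<xi> ` {..N}) n x = \<xi> 0"
    using False x by (intro flatten_at_node[OF _ n]) (auto simp: field_simps)
  then show ?thesis by simp
qed

lemma flatten_right:
  assumes nodes: "interval_nodes a b N \<xi>" and n: "separated (\<xi> ` {..N}) n"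
    and x: "\<xi> N - 1 / real n < x"
  shows "\<xi> N \<le> flatten (\<xi> ` {..N}) n x"
proof (cases "\<xi> N \<le> x")
  case True
  have "cell (\<xi> ` {..N}) {\<xi> N..}"
    by (rule mesh_cells_cell[OF nodes]) (simp add: mesh_cells_def)
  from flatten_cell[OF _ n this, of x] True show ?thesis by simp
next
  case False
  have "real n > 0" using n by (simp add: separated_def)
  then have "flatten (\<xi> ` {..N}) n x = \<xi> N"
    using False x by (intro flatten_at_node[OF _ n]) (auto simp: field_simps)
  then show ?thesis by simp
qed

text \<open>
  The approximants \<open>v (flatten X n x, flatten Y n y)\<close> coincide near each point with one polynomial \<open>c C D\<close>
  of \<open>v\<close>, evaluated at the flattened coordinates, where \<open>C\<close> and \<open>D\<close> are cells that contain \<open>x\<close> and \<open>y\<close>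
  and do not depend on \<open>n\<close>. By the chain rule their derivatives are those of the polynomial,
  \<open>P1 C D\<close> and \<open>P2 C D\<close>, times the bounded slopes of the flattening maps.
\<close>

lemma fe_space_2d_test_limit:
  assumes nodes: "interval_nodes x0 x1 N \<xi>" "interval_nodes y0 y1 M \<eta>"
    and v: "v \<in> fe_space_2d N \<xi> r M \<eta> s"
  shows "\<exists>\<phi> g B. bounded_test_limit ({x0<..<x1} \<times> {y0<..<y1}) \<phi> v g B"
proof -
  let ?\<Omega> = "{x0<..<x1} \<times> {y0<..<y1}"
  define X where "X = \<xi> ` {..N}"
  define Y where "Y = \<eta> ` {..M}"
  define L where "L = {..r} \<times> {..s}"
  have fin: "finite X" "finite Y" "finite L" by (simp_all add: X_def Y_def L_def)
  have ends: "\<xi> 0 = x0" "\<xi> N = x1" "\<eta> 0 = y0" "\<eta> M = y1"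
    using nodes by (simp_all add: interval_nodes_def)
  have cellX: "cell X C" if "C \<in> mesh_cells N \<xi>" for C
    using mesh_cells_cell[OF nodes(1) that] by (simp add: X_def)
  have cellY: "cell Y C" if "C \<in> mesh_cells M \<eta>" for C
    using mesh_cells_cell[OF nodes(2) that] by (simp add: Y_def)
  define c where "c C D = (SOME c. (\<forall>x\<in>C. \<forall>y\<in>D. v (x, y) = (\<Sum>(a, b)\<in>L. c a b * x ^ a * y ^ b)) \<and>
      (bounded C \<and> bounded D \<or> (\<forall>a b. c a b = 0)))" for C D
  have c: "(\<forall>x\<in>C. \<forall>y\<in>D. v (x, y) = (\<Sum>(a, b)\<in>L. c C D a b * x ^ a * y ^ b)) \<and>
      (bounded C \<and> bounded D \<or> (\<forall>a b. c C D a b = 0))"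
    if "C \<in> mesh_cells N \<xi>" "D \<in> mesh_cells M \<eta>" for C D
    using someI_ex[OF fe_space_2d_cell_poly[OF v that]] unfolding c_def L_def .
  define P1 where "P1 C D x y = (\<Sum>l\<in>L. (c C D (fst l) (snd l) * real (fst l)) * x ^ (fst l - 1) * y ^ snd l)" for C D x y
  define P2 where "P2 C D x y = (\<Sum>l\<in>L. (c C D (fst l) (snd l) * real (snd l)) * x ^ fst l * y ^ (snd l - 1))" for C D x y
  define S where "S = (\<Union>C\<in>mesh_cells N \<xi>. \<Union>D\<in>mesh_cells M \<eta>.
      (\<lambda>(x, y). P1 C D x y) ` (C \<times> D) \<union> (\<lambda>(x, y). P2 C D x y) ` (C \<times> D))"
  have "bounded S"
    unfolding S_def
  proof (intro bounded_UN bounded_Un[THEN iffD2] ballI conjI)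
    fix C D assume CD: "C \<in> mesh_cells N \<xi>" "D \<in> mesh_cells M \<eta>"
    show "bounded ((\<lambda>(x, y). P1 C D x y) ` (C \<times> D))" "bounded ((\<lambda>(x, y). P2 C D x y) ` (C \<times> D))"
    proof (atomize (full), cases "bounded C \<and> bounded D")
      case True
      then show "bounded ((\<lambda>(x, y). P1 C D x y) ` (C \<times> D)) \<and> bounded ((\<lambda>(x, y). P2 C D x y) ` (C \<times> D))"
        unfolding P1_def P2_def by (intro conjI bounded_power_sum fin) auto
    next
      case False
      with c[OF CD] have "P1 C D x y = 0" "P2 C D x y = 0" for x y by (auto simp: P1_def P2_def)
      then have "(\<lambda>(x, y). P1 C D x y) ` (C \<times> D) \<subseteq> {0}" "(\<lambda>(x, y). P2 C D x y) ` (C \<times> D) \<subseteq> {0}"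
        by auto
      then show "bounded ((\<lambda>(x, y). P1 C D x y) ` (C \<times> D)) \<and> bounded ((\<lambda>(x, y). P2 C D x y) ` (C \<times> D))"
        using bounded_subset[of "{0 :: real}"] by simp
    qed
  qed (simp_all add: mesh_cells_def)
  then obtain K where S: "\<And>t. t \<in> S \<Longrightarrow> norm t \<le> K"
    unfolding bounded_iff by blast
  have K: "\<bar>P1 C D x y\<bar> \<le> K" "\<bar>P2 C D x y\<bar> \<le> K"
    if "C \<in> mesh_cells N \<xi>" "D \<in> mesh_cells M \<eta>" "x \<in> C" "y \<in> D" for C D x y
  proof -
    have "(\<lambda>(x, y). P1 C D x y) (x, y) \<in> S" "(\<lambda>(x, y). P2 C D x y) (x, y) \<in> S"
      unfolding S_def using that by blast+
    from S[OF this(1)] S[OF this(2)] show "\<bar>P1 C D x y\<bar> \<le> K" "\<bar>P2 C D x y\<bar> \<le> K" by simp_all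
  qed
  define \<phi> where "\<phi> n z = v (flatten X n (fst z), flatten Y n (snd z))" for n z
  have rep: "\<exists>U W. open U \<and> open W \<and> x \<in> U \<and> y \<in> W \<and> (\<forall>x\<in>U. \<forall>y\<in>W. \<phi> n (x, y) =
      (\<Sum>l\<in>L. (c C D (fst l) (snd l) * flatten X n x ^ fst l) * (flatten Y n y ^ snd l)))"
    if n: "separated X n" "separated Y n"
      and CD: "C \<in> mesh_cells N \<xi>" "D \<in> mesh_cells M \<eta>" "x \<in> C" "y \<in> D" for n C D x y
  proof -
    obtain U where U: "open U" "x \<in> U" "\<And>t. t \<in> U \<Longrightarrow> flatten X n t \<in> C"
      using flatten_locally_in_cell[OF fin(1) n(1) cellX[OF CD(1)] CD(3)] by metis
    obtain W where W: "open W" "y \<in> W" "\<And>t. t \<in> W \<Longrightarrow> flatten Y n t \<in> D"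
      using flatten_locally_in_cell[OF fin(2) n(2) cellY[OF CD(2)] CD(4)] by metis
    show ?thesis
      using U W c[OF CD(1,2)]
      by (intro exI[of _ U] exI[of _ W]) (auto simp: \<phi>_def case_prod_beta)
  qed
  have sm: "smooth1 (\<lambda>x. c C D (fst l) (snd l) * flatten X n x ^ fst l)" "smooth1 (\<lambda>y. flatten Y n y ^ snd l)"
    for n C D l by (intro smooth1_intros smooth1_flatten)+
  have der: "frechet_derivative (\<phi> n) (at (x, y)) e =
      fst e * (deriv (flatten X n) x * P1 C D (flatten X n x) (flatten Y n y)) +
      snd e * (deriv (flatten Y n) y * P2 C D (flatten X n x) (flatten Y n y))"
    if n: "separated X n" "separated Y n"
      and CD: "C \<in> mesh_cells N \<xi>" "D \<in> mesh_cells M \<eta>" "x \<in> C" "y \<in> D" for n C D x y e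
  proof -
    obtain U W where UW: "open U" "open W" "x \<in> U" "y \<in> W"
      "\<And>x y. x \<in> U \<Longrightarrow> y \<in> W \<Longrightarrow> \<phi> n (x, y) =
        (\<Sum>l\<in>L. (c C D (fst l) (snd l) * flatten X n x ^ fst l) * (flatten Y n y ^ snd l))"
      using rep[OF n CD] by blast
    have d: "deriv (\<lambda>s. k * flatten Z n s ^ a) t = k * (real a * flatten Z n t ^ (a - 1) * deriv (flatten Z n) t)"
      for k Z a t
      by (rule DERIV_imp_deriv)
         (auto intro!: derivative_eq_intros smooth1_deriv(1)[OF smooth1_flatten])
    have "(\<phi> n has_derivative (\<lambda>(\<alpha>, \<beta>).
        \<alpha> * (\<Sum>l\<in>L. deriv (\<lambda>x. c C D (fst l) (snd l) * flatten X n x ^ fst l) (fst (x, y)) * (flatten Y n (snd (x, y)) ^ snd l)) +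
        \<beta> * (\<Sum>l\<in>L. c C D (fst l) (snd l) * flatten X n (fst (x, y)) ^ fst l * deriv (\<lambda>y. flatten Y n y ^ snd l) (snd (x, y))))) (at (x, y))"
      by (rule has_derivative_transform_within_open[OF separable_has_derivative[OF sm], where s = "U \<times> W"])
         (use UW in \<open>auto simp: open_Times\<close>)
    note fd = frechet_derivative_at[OF this, symmetric]
    have dY: "deriv (\<lambda>y. flatten Y n y ^ a) t = real a * flatten Y n t ^ (a - 1) * deriv (flatten Y n) t" for a t
      using d[of 1 Y a t] by simp
    show ?thesis
      unfolding fd P1_def P2_def d dY case_prod_beta fst_conv snd_conv
      by (simp add: sum_distrib_left mult_ac)
  qed
  have test: "\<phi> n \<in> test_funs ?\<Omega>" if n: "separated X n" "separated Y n" for n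
  proof -
    define h where "h = 1 / real n"
    have "smooth_fun (\<phi> n)"
    proof (rule smooth_fun_locally_separable)
      fix x y
      obtain C D where CD: "C \<in> mesh_cells N \<xi>" "D \<in> mesh_cells M \<eta>" "x \<in> C" "y \<in> D"
        using mesh_cells_cover by metis
      obtain U W where "open U \<and> open W \<and> x \<in> U \<and> y \<in> W \<and> (\<forall>x\<in>U. \<forall>y\<in>W. \<phi> n (x, y) =
        (\<Sum>l\<in>L. (c C D (fst l) (snd l) * flatten X n x ^ fst l) * (flatten Y n y ^ snd l)))"
        using rep[OF n CD] by blast
      then show "\<exists>U W (L :: (nat \<times> nat) set) f g. open U \<and> open W \<and> x \<in> U \<and> y \<in> W \<and>
          (\<forall>l\<in>L. smooth1 (f l) \<and> smooth1 (g l)) \<and>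
          (\<forall>x\<in>U. \<forall>y\<in>W. \<phi> n (x, y) = (\<Sum>l\<in>L. f l x * g l y))"
        using sm
        by (intro exI[of _ U] exI[of _ W] exI[of _ L]
            exI[of _ "\<lambda>l x. c C D (fst l) (snd l) * flatten X n x ^ fst l"]
            exI[of _ "\<lambda>l y. flatten Y n y ^ snd l"]) simp
    qed
    moreover have "\<exists>K. compact K \<and> K \<subseteq> ?\<Omega> \<and> (\<forall>z. z \<notin> K \<longrightarrow> \<phi> n z = 0)"
    proof (intro exI[of _ "{x0 + h..x1 - h} \<times> {y0 + h..y1 - h}"] conjI allI impI)
      show "compact ({x0 + h..x1 - h} \<times> {y0 + h..y1 - h})"
        by (intro compact_Times) auto
      have "0 < h" using n by (simp add: separated_def h_def)
      then show "{x0 + h..x1 - h} \<times> {y0 + h..y1 - h} \<subseteq> ?\<Omega>" by auto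
      fix z assume z: "z \<notin> {x0 + h..x1 - h} \<times> {y0 + h..y1 - h}"
      have "(flatten X n (fst z), flatten Y n (snd z)) \<notin> {\<xi> 0<..<\<xi> N} \<times> {\<eta> 0<..<\<eta> M}"
        using z flatten_left[OF nodes(1), of n "fst z"] flatten_left[OF nodes(2), of n "snd z"]
          flatten_right[OF nodes(1), of n "fst z"] flatten_right[OF nodes(2), of n "snd z"] n
        by (auto simp: X_def Y_def ends mem_Times_iff not_le h_def)
      then show "\<phi> n z = 0"
        unfolding \<phi>_def by (rule fe_space_2d_outside[OF v])
    qed
    ultimately show ?thesis unfolding test_funs_def by blast
  qed
  \<comment> \<open>Different nodes do not interfere from the index \<open>n0\<close> on, so the sequence is shifted by \<open>n0\<close> below.\<close>
  obtain n0 where n0: "\<And>n. n0 \<le> n \<Longrightarrow> separated X n" "\<And>n. n0 \<le> n \<Longrightarrow> separated Y n"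
    using eventually_conj[OF eventually_separated[OF fin(1)] eventually_separated[OF fin(2)]]
    unfolding eventually_sequentially by blast
  obtain B0 where B0: "\<And>z. \<bar>v z\<bar> \<le> B0" using fe_space_2d_bounded[OF v] by metis
  obtain B1 where B1: "\<And>n x. n > 0 \<Longrightarrow> \<bar>deriv (flatten X n) x\<bar> \<le> B1" using deriv_flatten_bounded by metis
  obtain B2 where B2: "\<And>n x. n > 0 \<Longrightarrow> \<bar>deriv (flatten Y n) x\<bar> \<le> B2" using deriv_flatten_bounded by metis
  define B where "B = max B0 (max (B1 * K) (B2 * K))"
  have basis: "e = (1, 0) \<or> e = (0, 1)" if "e \<in> Basis" for e :: "real \<times> real"
    using that by (auto simp: Basis_prod_def)
  have bound': "\<bar>frechet_derivative (\<phi> n) (at z) e\<bar> \<le> B" if n: "n0 \<le> n" and e: "e \<in> Basis" for n z e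
  proof -
    obtain x y where z: "z = (x, y)" by fastforce
    obtain C D where CD: "C \<in> mesh_cells N \<xi>" "D \<in> mesh_cells M \<eta>" "x \<in> C" "y \<in> D"
      using mesh_cells_cover by metis
    have "n > 0" using n0(1)[OF n] by (simp add: separated_def)
    have mem: "flatten X n x \<in> C" "flatten Y n y \<in> D"
      using flatten_cell fin n0[OF n] cellX cellY CD by blast+
    have "\<bar>deriv (flatten X n) x * P1 C D (flatten X n x) (flatten Y n y)\<bar> \<le> B1 * K"
      unfolding abs_mult using B1[OF \<open>n > 0\<close>, of x] K(1)[OF CD(1,2) mem] by (intro mult_mono) auto
    moreover have "\<bar>deriv (flatten Y n) y * P2 C D (flatten X n x) (flatten Y n y)\<bar> \<le> B2 * K"
      unfolding abs_mult using B2[OF \<open>n > 0\<close>, of y] K(2)[OF CD(1,2) mem] by (intro mult_mono) auto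
    ultimately show ?thesis
      using basis[OF e] unfolding z der[OF n0(1,2)[OF n] CD] B_def by auto
  qed
  have conv: "convergent (\<lambda>n. frechet_derivative (\<phi> n) (at z) e)" for z e
  proof -
    obtain x y where z: "z = (x, y)" by fastforce
    obtain C D where CD: "C \<in> mesh_cells N \<xi>" "D \<in> mesh_cells M \<eta>" "x \<in> C" "y \<in> D"
      using mesh_cells_cover by metis
    have "\<forall>\<^sub>F n in sequentially. frechet_derivative (\<phi> n) (at z) e =
        fst e * ((if x \<in> X then 0 else 1) * P1 C D x y) + snd e * ((if y \<in> Y then 0 else 1) * P2 C D x y)"
      using flatten_eventually[OF fin(1), of x] flatten_eventually[OF fin(2), of y]
        eventually_separated[OF fin(1)] eventually_separated[OF fin(2)]
      unfolding z by eventually_elim (simp add: der[OF _ _ CD])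
    from tendsto_eventually[OF this] show ?thesis by (rule convergentI)
  qed
  have limv: "(\<lambda>n. \<phi> n z) \<longlonglongrightarrow> v z" for z
  proof (rule tendsto_eventually)
    show "\<forall>\<^sub>F n in sequentially. \<phi> n z = v z"
      using flatten_eventually(1)[OF fin(1), of "fst z"] flatten_eventually(1)[OF fin(2), of "snd z"]
      by eventually_elim (simp add: \<phi>_def)
  qed
  have "bounded_test_limit ?\<Omega> (\<lambda>n. \<phi> (n + n0)) v (\<lambda>e z. lim (\<lambda>n. frechet_derivative (\<phi> n) (at z) e)) B"
  proof
    show "open ?\<Omega>" "bounded ?\<Omega>" by (auto intro: open_Times bounded_Times)
    show "\<phi> (n + n0) \<in> test_funs ?\<Omega>" for n using test n0 by simp
    show "\<bar>\<phi> (n + n0) z\<bar> \<le> B" for n z using B0 by (simp add: \<phi>_def B_def le_max_iff_disj)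
    show "\<bar>frechet_derivative (\<phi> (n + n0)) (at z) e\<bar> \<le> B" if "e \<in> Basis" for n e z
      using bound' that by simp
    show "(\<lambda>n. \<phi> (n + n0) z) \<longlonglongrightarrow> v z" for z
      by (rule LIMSEQ_ignore_initial_segment[OF limv])
    show "(\<lambda>n. frechet_derivative (\<phi> (n + n0)) (at z) e) \<longlonglongrightarrow> lim (\<lambda>n. frechet_derivative (\<phi> n) (at z) e)" for e z
      by (rule LIMSEQ_ignore_initial_segment) (use conv convergent_LIMSEQ_iff in blast)
  qed
  then show ?thesis by (intro exI)
qed

lemma fe_space_2d_subset_W1_zero:
  assumes "interval_nodes x0 x1 N \<xi>" "interval_nodes y0 y1 M \<eta>" "p > 0"
  shows "fe_space_2d N \<xi> r M \<eta> s \<subseteq> W1_zero ({x0<..<x1} \<times> {y0<..<y1}) p"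
proof
  fix v assume "v \<in> fe_space_2d N \<xi> r M \<eta> s"
  then obtain \<phi> g B where "bounded_test_limit ({x0<..<x1} \<times> {y0<..<y1}) \<phi> v g B"
    using fe_space_2d_test_limit[OF assms(1,2)] by metis
  then show "v \<in> W1_zero ({x0<..<x1} \<times> {y0<..<y1}) p"
    using assms(3) by (rule bounded_test_limit.limit_in_W1_zero)
qed

lemma fe_space_2d_lincomb:
  assumes "v \<in> fe_space_2d N \<xi> r M \<eta> s" "w \<in> fe_space_2d N \<xi> r M \<eta> s"
  shows "(\<lambda>z. \<alpha> * v z + \<beta> * w z) \<in> fe_space_2d N \<xi> r M \<eta> s"
  unfolding fe_space_2d_def
proof (intro CollectI conjI allI impI)
  show "continuous_on UNIV (\<lambda>z. \<alpha> * v z + \<beta> * w z)"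
    using assms unfolding fe_space_2d_def by (auto intro!: continuous_intros)
  show "\<alpha> * v z + \<beta> * w z = 0" if "z \<notin> {\<xi> 0<..<\<xi> N} \<times> {\<eta> 0<..<\<eta> M}" for z
    using fe_space_2d_outside[OF assms(1) that] fe_space_2d_outside[OF assms(2) that] by simp
  fix i j assume ij: "i < N" "j < M"
  obtain c where c: "\<And>x y. x \<in> {\<xi> i..\<xi> (Suc i)} \<Longrightarrow> y \<in> {\<eta> j..\<eta> (Suc j)} \<Longrightarrow>
      v (x, y) = (\<Sum>a\<le>r. \<Sum>b\<le>s. c a b * x ^ a * y ^ b)"
    using assms(1) ij unfolding fe_space_2d_def by blast
  obtain d where d: "\<And>x y. x \<in> {\<xi> i..\<xi> (Suc i)} \<Longrightarrow> y \<in> {\<eta> j..\<eta> (Suc j)} \<Longrightarrow>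
      w (x, y) = (\<Sum>a\<le>r. \<Sum>b\<le>s. d a b * x ^ a * y ^ b)"
    using assms(2) ij unfolding fe_space_2d_def by blast
  show "\<exists>c. \<forall>x\<in>{\<xi> i..\<xi> (Suc i)}. \<forall>y\<in>{\<eta> j..\<eta> (Suc j)}.
      \<alpha> * v (x, y) + \<beta> * w (x, y) = (\<Sum>a\<le>r. \<Sum>b\<le>s. c a b * x ^ a * y ^ b)"
    by (intro exI[of _ "\<lambda>a b. \<alpha> * c a b + \<beta> * d a b"] ballI)
       (simp add: c d sum_distrib_left sum.distrib distrib_right mult.assoc)
qed

lemma zero_in_fe_space_2d: "(\<lambda>z. 0) \<in> fe_space_2d N \<xi> r M \<eta> s"
  unfolding fe_space_2d_def by (auto intro!: exI[of _ "\<lambda>_ _. 0"])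

lemma fe_space_tensor:
  assumes u: "u \<in> fe_space_1d N \<xi> r" and w: "w \<in> fe_space_1d M \<eta> s"
  shows "(\<lambda>(x, y). u x * w y) \<in> fe_space_2d N \<xi> r M \<eta> s"
  unfolding fe_space_2d_def
proof (intro CollectI conjI allI impI)
  show "continuous_on UNIV (\<lambda>(x, y). u x * w y)"
  proof -
    have "continuous_on UNIV u" "continuous_on UNIV w" using u w by (auto simp: fe_space_1d_def)
    then have "continuous_on UNIV (\<lambda>z. u (fst z) * w (snd z))"
      by (auto intro!: continuous_intros continuous_on_compose2[of UNIV u] continuous_on_compose2[of UNIV w])
    then show ?thesis by (simp add: case_prod_beta)
  qed
  show "(case z of (x, y) \<Rightarrow> u x * w y) = 0" if "z \<notin> {\<xi> 0<..<\<xi> N} \<times> {\<eta> 0<..<\<eta> M}" for z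
  proof -
    have "\<And>x. x \<notin> {\<xi> 0<..<\<xi> N} \<Longrightarrow> u x = 0" "\<And>y. y \<notin> {\<eta> 0<..<\<eta> M} \<Longrightarrow> w y = 0"
      using u w unfolding fe_space_1d_def by blast+
    with that show ?thesis by (cases z) fastforce
  qed
  fix i j assume ij: "i < N" "j < M"
  obtain c where c: "\<And>x. x \<in> {\<xi> i..\<xi> (Suc i)} \<Longrightarrow> u x = (\<Sum>a\<le>r. c a * x ^ a)"
    using u ij unfolding fe_space_1d_def by blast
  obtain d where d: "\<And>y. y \<in> {\<eta> j..\<eta> (Suc j)} \<Longrightarrow> w y = (\<Sum>b\<le>s. d b * y ^ b)"
    using w ij unfolding fe_space_1d_def by blast
  show "\<exists>c. \<forall>x\<in>{\<xi> i..\<xi> (Suc i)}. \<forall>y\<in>{\<eta> j..\<eta> (Suc j)}.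
      (case (x, y) of (x, y) \<Rightarrow> u x * w y) = (\<Sum>a\<le>r. \<Sum>b\<le>s. c a b * x ^ a * y ^ b)"
    by (intro exI[of _ "\<lambda>a b. c a * d b"] ballI)
       (simp add: c d sum_product mult_ac)
qed

lemma reduced_space_subset:
  assumes "\<And>l. l \<in> {1..m} \<Longrightarrow> \<phi> l \<in> fe_space_1d M \<eta> s"
  shows "reduced_space (fe_space_1d N \<xi> r) m \<phi> \<subseteq> fe_space_2d N \<xi> r M \<eta> s"
proof
  fix v assume "v \<in> reduced_space (fe_space_1d N \<xi> r) m \<phi>"
  then obtain u where v: "v = (\<lambda>(x, y). \<Sum>l=1..m. u l x * \<phi> l y)"
    and u: "\<And>l. l \<in> {1..m} \<Longrightarrow> u l \<in> fe_space_1d N \<xi> r"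
    unfolding reduced_space_def by blast
  have "finite S \<Longrightarrow> S \<subseteq> {1..m} \<Longrightarrow> (\<lambda>(x, y). \<Sum>l\<in>S. u l x * \<phi> l y) \<in> fe_space_2d N \<xi> r M \<eta> s" for S
  proof (induction S rule: finite_induct)
    case (insert l S)
    have "(\<lambda>(x, y). u l x * \<phi> l y) \<in> fe_space_2d N \<xi> r M \<eta> s"
      using insert.prems by (intro fe_space_tensor u assms) auto
    moreover have "(\<lambda>(x, y). \<Sum>l\<in>S. u l x * \<phi> l y) \<in> fe_space_2d N \<xi> r M \<eta> s"
      using insert by simp
    ultimately show ?case
      using fe_space_2d_lincomb[of _ N \<xi> r M \<eta> s _ 1 1] insert.hyps by (fastforce simp: case_prod_beta)
  qed (simp add: split_def zero_in_fe_space_2d)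
  from this[of "{1..m}"] show "v \<in> fe_space_2d N \<xi> r M \<eta> s" using v by simp
qed

section \<open>Mean value theorem and effectivity of the estimator\<close>

lemma W1_zero_subset_W1: "W1_zero \<Omega> p \<subseteq> W1 \<Omega> p"
  by (auto simp: W1_zero_def)

lemma W1_seminorm_nonneg: "0 \<le> W1_seminorm \<Omega> p v"
  by (simp add: W1_seminorm_def)

lemma C1_frechetD:
  assumes "C1_frechet \<Omega> p q F F'" "w \<in> W1_zero \<Omega> p"
  shows C1_frechet_dual: "F w \<in> dual_W1_zero \<Omega> q"
    and C1_frechet_deriv_dual: "h \<in> W1_zero \<Omega> p \<Longrightarrow> F' w h \<in> dual_W1_zero \<Omega> q"
    and C1_frechet_deriv_bounded: "\<exists>C. \<forall>h\<in>W1_zero \<Omega> p. \<forall>v\<in>W1_zero \<Omega> q.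
        \<bar>F' w h v\<bar> \<le> C * W1_seminorm \<Omega> p h * W1_seminorm \<Omega> q v"
  using assms(1)[unfolded C1_frechet_def, THEN conjunct1, rule_format, OF assms(2)]
    assms(1)[unfolded C1_frechet_def, THEN conjunct2, THEN conjunct1, rule_format, OF assms(2)]
    assms(1)[unfolded C1_frechet_def, THEN conjunct2, THEN conjunct2, THEN conjunct2, THEN conjunct1,
      THEN bspec, OF assms(2)]
  by simp_all

text \<open>
  The Frechet derivative along the segment from \<open>w\<close> to \<open>w + e\<close> is the derivative of a real function of
  one variable, to which the mean value theorem applies. The parameter \<open>\<epsilon>\<close> is chosen such that the
  Frechet remainder, divided by the increment, stays below \<open>r\<close>; adding 1 covers vanishing seminorms.
\<close>

lemma C1_frechet_mean_value:
  assumes F: "C1_frechet \<Omega> p q F F'" and \<Omega>: "open \<Omega>" and p: "p > 0"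
    and line: "\<And>t. (\<lambda>z. w z + t * e z) \<in> W1_zero \<Omega> p"
    and scaled: "\<And>t. (\<lambda>z. t * e z) \<in> W1_zero \<Omega> p"
    and v: "v \<in> W1_zero \<Omega> q"
  shows "\<exists>t. 0 < t \<and> t < 1 \<and>
    F (\<lambda>z. w z + e z) v - F w v = F' (\<lambda>z. w z + t * e z) e v"
proof -
  let ?w = "\<lambda>t z. w z + t * e z"
  have e: "e \<in> W1_zero \<Omega> p" using scaled[of 1] by simp
  have "((\<lambda>t. F (?w t) v) has_real_derivative F' (?w t) e v) (at t)" for t
    unfolding DERIV_def
  proof (rule LIM_I)
    fix r :: real assume r: "0 < r"
    let ?a = "W1_seminorm \<Omega> p e" and ?b = "W1_seminorm \<Omega> q v"
    have ab: "0 \<le> ?a" "0 \<le> ?b" by (rule W1_seminorm_nonneg)+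
    define \<epsilon> where "\<epsilon> = r / (?a * ?b + 1)"
    have \<epsilon>: "0 < \<epsilon>" using r ab by (simp add: \<epsilon>_def add_nonneg_pos)
    have "\<exists>\<delta>>0. \<forall>h\<in>W1_zero \<Omega> p. W1_seminorm \<Omega> p h < \<delta> \<longrightarrow>
        (\<forall>v\<in>W1_zero \<Omega> q. \<bar>F (?w t + h) v - F (?w t) v - F' (?w t) h v\<bar>
            \<le> \<epsilon> * W1_seminorm \<Omega> p h * W1_seminorm \<Omega> q v)"
      using F line[of t] \<epsilon> unfolding C1_frechet_def by meson
    then obtain \<delta> where \<delta>: "\<delta> > 0" "\<And>h. h \<in> W1_zero \<Omega> p \<Longrightarrow> W1_seminorm \<Omega> p h < \<delta> \<Longrightarrow>
        \<bar>F (?w t + h) v - F (?w t) v - F' (?w t) h v\<bar> \<le> \<epsilon> * W1_seminorm \<Omega> p h * ?b"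
      using v by blast
    show "\<exists>s>0. \<forall>x. x \<noteq> 0 \<and> norm (x - 0) < s \<longrightarrow>
        norm ((F (?w (t + x)) v - F (?w t) v) / x - F' (?w t) e v) < r"
    proof (intro exI[of _ "\<delta> / (?a + 1)"] conjI allI impI)
      show "0 < \<delta> / (?a + 1)" using \<delta>(1) ab by simp
      fix x :: real assume x: "x \<noteq> 0 \<and> norm (x - 0) < \<delta> / (?a + 1)"
      let ?h = "\<lambda>z. x * e z"
      have nh: "W1_seminorm \<Omega> p ?h = \<bar>x\<bar> * ?a"
        using e W1_zero_subset_W1 by (intro W1_seminorm_scale[OF \<Omega> _ p]) blast
      have "\<bar>x\<bar> * (?a + 1) < \<delta>" using x ab by (simp add: pos_less_divide_eq)
      then have "\<bar>x\<bar> * ?a < \<delta>" using abs_ge_zero[of x] by (simp add: distrib_left)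
      then have "\<bar>F (?w t + ?h) v - F (?w t) v - F' (?w t) ?h v\<bar> \<le> \<epsilon> * (\<bar>x\<bar> * ?a) * ?b"
        using \<delta>(2)[OF scaled[of x]] unfolding nh by blast
      moreover have "F' (?w t) (\<lambda>z. x * e z + 0 * e z) v = x * F' (?w t) e v + 0 * F' (?w t) e v"
        using F line[of t] e v unfolding C1_frechet_def by meson
      moreover have "?w t + ?h = ?w (t + x)" by (simp add: fun_eq_iff algebra_simps)
      ultimately have "\<bar>F (?w (t + x)) v - F (?w t) v - x * F' (?w t) e v\<bar> \<le> \<bar>x\<bar> * (\<epsilon> * (?a * ?b))"
        by (simp add: mult_ac)
      moreover have "(F (?w (t + x)) v - F (?w t) v) / x - F' (?w t) e v =
          (F (?w (t + x)) v - F (?w t) v - x * F' (?w t) e v) / x"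
        using x by (simp add: diff_divide_distrib)
      ultimately have "norm ((F (?w (t + x)) v - F (?w t) v) / x - F' (?w t) e v) \<le> \<epsilon> * (?a * ?b)"
        using x by (simp add: abs_divide pos_divide_le_eq mult.commute)
      also have "\<dots> < \<epsilon> * (?a * ?b + 1)" using \<epsilon> by simp
      also have "\<dots> = r"
      proof -
        have "?a * ?b + 1 \<noteq> 0" using mult_nonneg_nonneg[OF ab] by linarith
        then show ?thesis by (simp add: \<epsilon>_def)
      qed
      finally show "norm ((F (?w (t + x)) v - F (?w t) v) / x - F' (?w t) e v) < r" .
    qed
  qed
  from MVT2[of 0 1, OF _ this] show ?thesis by auto
qed

lemma dual_W1_zero_minus:
  assumes "G \<in> dual_W1_zero \<Omega> q" "v \<in> W1_zero \<Omega> q"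
  shows "G (\<lambda>z. - v z) = - G v"
proof -
  have "G (\<lambda>z. (-1) * v z + 0 * v z) = (-1) * G v + 0 * G v"
    using assms unfolding dual_W1_zero_def by blast
  then show ?thesis by simp
qed

text \<open>
  With \<open>e\<close>, \<open>r\<close> the dual norms of the projection error and of the projected residual, and \<open>a\<close> the norm of
  the error of the reduced solution: the bounds \<open>err\<close> and \<open>res\<close> give
  \<open>e + r \<le> (1 + c) / (1 - c) * (2 * g * a)\<close>, and the concave function \<open>sqrt\<close> satisfies
  \<open>sqrt (1 - t) \<ge> 1 - t\<close> on \<open>{0..1}\<close>. For a negative \<open>t\<close> the left-hand side is negative.
\<close>

lemma real_estimate:
  fixes b l g a e r c :: real
  assumes pos: "0 < b" "0 < l" "0 \<le> g * a" "0 \<le> c" "c < 1"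
    and err: "e \<le> c * r" and res: "r \<le> 2 * (g * a) + e"
    and tau: "2 * l / b\<^sup>2 * (e + r) \<le> (1 - c) / (1 + c) / 2"
  shows "b / l * (1 - sqrt (1 - 2 * l / b\<^sup>2 * (e + r))) \<le> 4 * inverse ((1 - c) / (1 + c)) * (g / b) * a"
proof -
  define \<tau> where "\<tau> = 2 * l / b\<^sup>2 * (e + r)"
  have rhs: "4 * inverse ((1 - c) / (1 + c)) * (g / b) * a = 2 / b * ((1 + c) / (1 - c) * (2 * (g * a)))"
    by (simp add: field_simps)
  have "(1 - c) * r \<le> 2 * (g * a)" using err res by (simp add: algebra_simps)
  then have "r \<le> 2 * (g * a) / (1 - c)" using pos by (simp add: pos_le_divide_eq mult.commute)
  then have "(1 + c) * r \<le> (1 + c) * (2 * (g * a) / (1 - c))" using pos by (intro mult_left_mono) auto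
  then have total: "e + r \<le> (1 + c) / (1 - c) * (2 * (g * a))" using err by (simp add: algebra_simps)
  show ?thesis
  proof (cases "0 \<le> \<tau>")
    case True
    have "(1 - c) / (1 + c) / 2 \<le> 1" using pos by (simp add: pos_divide_le_eq)
    with tau have "\<tau> \<le> 1" unfolding \<tau>_def by (rule order_trans)
    have "1 - \<tau> \<le> sqrt (1 - \<tau>)"
      using True \<open>\<tau> \<le> 1\<close> by (intro real_le_rsqrt) (simp add: power2_eq_square mult_left_le)
    then have "b / l * (1 - sqrt (1 - \<tau>)) \<le> b / l * \<tau>" using pos by (intro mult_left_mono) auto
    also have "\<dots> = 2 / b * (e + r)" using pos by (simp add: \<tau>_def power2_eq_square field_simps)
    also have "\<dots> \<le> 2 / b * ((1 + c) / (1 - c) * (2 * (g * a)))"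
      using total pos by (intro mult_left_mono) auto
    finally show ?thesis unfolding rhs \<tau>_def .
  next
    case False
    then have "b / l * (1 - sqrt (1 - \<tau>)) \<le> 0"
      using pos by (intro mult_nonneg_nonpos) auto
    also have "0 \<le> 2 / b * ((1 + c) / (1 - c) * (2 * (g * a)))"
      using pos mult_nonneg_nonneg[of "(1 + c) / (1 - c)" "2 * (g * a)"]
      by (intro mult_nonneg_nonneg[of "2 / b"]) auto
    finally show ?thesis unfolding rhs \<tau>_def .
  qed
qed

text \<open>
  Here \<open>c\<close> is the reduced solution, \<open>u\<close> the full one and \<open>G\<close> the projected residual at \<open>c\<close>. The constants
  are extended reals, and the quotients defining them have the value \<open>0\<close> when a seminorm in the
  denominator vanishes. Both are harmless: a positive \<open>L\<close> makes \<open>V\<close> nontrivial, continuity of \<open>F' c\<close> makes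
  \<open>\<gamma>\<close> and with it \<open>\<beta>\<close> finite, a positive \<open>\<beta>\<close> makes the \<open>p\<close>-seminorm definite on \<open>V\<close>, and the
  functionals \<open>F w\<close> and \<open>F' w h\<close> vanish wherever the \<open>q\<close>-seminorm does.
\<close>

lemma estimator_effectivity:
  fixes \<Omega> :: "(real \<times> real) set" and p q R c_err :: real and c u :: plane_fun
    and F :: "plane_fun \<Rightarrow> plane_fun \<Rightarrow> real"
    and F' :: "plane_fun \<Rightarrow> plane_fun \<Rightarrow> plane_fun \<Rightarrow> real" and G :: "plane_fun \<Rightarrow> real" and V :: "plane_fun set"
  defines "\<beta> \<equiv> infsup_const \<Omega> p q V (F' c)"
    and "\<gamma> \<equiv> continuity_const \<Omega> p q V (F' c)"
    and "L \<equiv> lipschitz_const \<Omega> p q V F' c R"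
    and "err \<equiv> dual_norm \<Omega> q V (\<lambda>v. F c v - G v)"
    and "res \<equiv> dual_norm \<Omega> q V G"
  assumes \<Omega>: "open \<Omega>" and pq: "p > 0" "q > 0"
    and V: "V \<subseteq> W1_zero \<Omega> p" "V \<subseteq> W1_zero \<Omega> q"
      "\<And>v w \<alpha> \<beta>. v \<in> V \<Longrightarrow> w \<in> V \<Longrightarrow> (\<lambda>z. \<alpha> * v z + \<beta> * w z) \<in> V"
    and C1: "C1_frechet \<Omega> p q F F'"
    and G: "\<And>v. v \<in> V \<Longrightarrow> G (\<lambda>z. - v z) = - G v"
    and c: "c \<in> V" and u: "u \<in> fe_ball \<Omega> p V c (\<beta> / L)" "\<And>v. v \<in> V \<Longrightarrow> F u v = 0"
    and \<beta>_pos: "0 < \<beta>" and L_bounds: "0 < L" "L < \<infinity>" and R: "\<beta> / L \<le> ereal R"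
    and c_err: "0 \<le> c_err" "c_err < 1" "err \<le> ereal c_err * res"
    and \<tau>: "2 * L / \<beta>\<^sup>2 * (err + res) \<le> ereal ((1 - c_err) / (1 + c_err) / 2)"
  shows "ereal (real_of_ereal (\<beta> / L) * (1 - sqrt (1 - real_of_ereal (2 * L / \<beta>\<^sup>2 * (err + res))))) \<le>
    ereal (4 * inverse ((1 - c_err) / (1 + c_err))) * (\<gamma> / \<beta>) * ereal (W1_seminorm \<Omega> p (u - c))"
proof -
  let ?P = "W1_seminorm \<Omega> p" and ?Q = "W1_seminorm \<Omega> q"
  have nn: "0 \<le> ?P v" "0 \<le> ?Q v" for v by (rule W1_seminorm_nonneg)+
  have Pscale: "?P (\<lambda>z. t * v z) = \<bar>t\<bar> * ?P v" if "v \<in> V" for t v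
    using that V(1) W1_zero_subset_W1 by (intro W1_seminorm_scale \<Omega> pq) blast
  have Qscale: "?Q (\<lambda>z. t * v z) = \<bar>t\<bar> * ?Q v" if "v \<in> V" for t v
    using that V(2) W1_zero_subset_W1 by (intro W1_seminorm_scale \<Omega> pq) blast
  have scaled: "(\<lambda>z. t * v z) \<in> V" if "v \<in> V" for t v using V(3)[OF that that, of t 0] by simp
  have minus: "(\<lambda>z. - v z) \<in> V" if "v \<in> V" for v using scaled[OF that, of "-1"] by simp
  have Qminus: "?Q (\<lambda>z. - v z) = ?Q v" if "v \<in> V" for v using Qscale[OF that, of "-1"] by simp
  have diff: "v - w \<in> V" if "v \<in> V" "w \<in> V" for v w
    using V(3)[OF that, of 1 "-1"] by (simp add: fun_diff_def)
  have P0: "?P 0 = 0" "?Q 0 = 0" using Pscale[OF c, of 0] Qscale[OF c, of 0] by (simp_all add: zero_fun_def)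
  have F'b: "\<exists>C. 0 \<le> C \<and> (\<forall>h\<in>V. \<forall>v\<in>V. \<bar>F' w h v\<bar> \<le> C * (?P h * ?Q v))" if "w \<in> V" for w
  proof -
    have "w \<in> W1_zero \<Omega> p" using that V(1) by blast
    then obtain C where C: "\<And>h v. h \<in> W1_zero \<Omega> p \<Longrightarrow> v \<in> W1_zero \<Omega> q \<Longrightarrow> \<bar>F' w h v\<bar> \<le> C * ?P h * ?Q v"
      using C1_frechet_deriv_bounded[OF C1] by blast
    have "\<bar>F' w h v\<bar> \<le> max C 0 * (?P h * ?Q v)" if "h \<in> V" "v \<in> V" for h v
    proof -
      have "C * (?P h * ?Q v) \<le> max C 0 * (?P h * ?Q v)"
        by (intro mult_right_mono mult_nonneg_nonneg nn) simp
      moreover have "\<bar>F' w h v\<bar> \<le> C * ?P h * ?Q v" using that V(1,2) by (intro C) auto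
      ultimately show ?thesis by (simp add: mult.assoc)
    qed
    then show ?thesis by (intro exI[of _ "max C 0"]) auto
  qed
  have F'zero: "F' w h v = 0" if w: "w \<in> V" and "h \<in> V" "v \<in> V" "?P h * ?Q v = 0" for w h v
  proof -
    obtain C where "\<And>h v. h \<in> V \<Longrightarrow> v \<in> V \<Longrightarrow> \<bar>F' w h v\<bar> \<le> C * (?P h * ?Q v)"
      using F'b[OF w] by blast
    from this[OF that(2,3)] that(4) show ?thesis by simp
  qed
  obtain d where d: "d \<in> V - {0}"
  proof -
    have "fe_ball \<Omega> p V c (ereal R) - {c} \<noteq> {}"
    proof
      assume "fe_ball \<Omega> p V c (ereal R) - {c} = {}"
      then have "L = - \<infinity>" unfolding L_def lipschitz_const_def by (simp only: SUP_empty) (simp add: bot_ereal_def)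
      with L_bounds show False by simp
    qed
    then obtain w where "w \<in> V" "w \<noteq> c" unfolding fe_ball_def by blast
    then have "w - c \<in> V - {0}" using diff c by simp
    then show ?thesis by (rule that)
  qed
  obtain b where b: "\<beta> = ereal b" "0 < b" and g0: "\<beta> \<le> \<gamma>" and "\<gamma> < \<infinity>"
  proof -
    obtain C where C: "0 \<le> C" "\<And>h v. h \<in> V \<Longrightarrow> v \<in> V \<Longrightarrow> \<bar>F' c h v\<bar> \<le> C * (?P h * ?Q v)"
      using F'b[OF c] by blast
    have "F' c h v / (?P h * ?Q v) \<le> C" if "h \<in> V" "v \<in> V" for h v
    proof (cases "?P h * ?Q v = 0")
      case True
      show ?thesis unfolding True using C(1) by simp
    next
      case False
      then have "0 < ?P h * ?Q v" using nn mult_nonneg_nonneg[of "?P h" "?Q v"] by (simp add: less_le)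
      then show ?thesis using C(2)[OF that] by (simp add: pos_divide_le_eq abs_le_iff)
    qed
    then have "\<gamma> \<le> ereal C" unfolding \<gamma>_def continuity_const_def by (intro SUP_least) simp
    then have 1: "\<gamma> < \<infinity>" by (rule le_less_trans) simp
    have 2: "\<beta> \<le> \<gamma>" unfolding \<beta>_def \<gamma>_def infsup_const_def continuity_const_def
      by (rule INF_lower2[OF d]) (rule SUP_upper[OF d])
    with 1 \<beta>_pos obtain b where "\<beta> = ereal b" "0 < b" by (cases \<beta>) auto
    with 1 2 show ?thesis using that by blast
  qed
  then obtain g where g: "\<gamma> = ereal g" "b \<le> g" by (cases \<gamma>) auto
  obtain l where l: "L = ereal l" "0 < l" using L_bounds by (cases L) auto
  have Ppos: "0 < ?P h" if "h \<in> V" "h \<noteq> 0" for h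
  proof (rule ccontr)
    assume "\<not> 0 < ?P h"
    then have "?P h = 0" using nn[of h] by linarith
    have "\<beta> \<le> (SUP v\<in>V - {0}. ereal (F' c h v / (?P h * ?Q v)))"
      unfolding \<beta>_def infsup_const_def using that by (intro INF_lower) simp
    also have "\<dots> \<le> 0" using \<open>?P h = 0\<close> by (intro SUP_least) (simp add: zero_ereal_def)
    finally show False using \<beta>_pos by simp
  qed
  have cont: "F' c h v \<le> g * (?P h * ?Q v)" if "h \<in> V" "v \<in> V" for h v
  proof (cases "?P h * ?Q v = 0")
    case True
    show ?thesis unfolding F'zero[OF c that True] True by simp
  next
    case False
    then have 0: "0 < ?P h * ?Q v" using nn mult_nonneg_nonneg[of "?P h" "?Q v"] by (simp add: less_le)
    have "h \<in> V - {0}" "v \<in> V - {0}" using that False P0 by auto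
    then have "ereal (F' c h v / (?P h * ?Q v)) \<le> \<gamma>"
      unfolding \<gamma>_def continuity_const_def by (intro SUP_upper2[of h] SUP_upper)
    then show ?thesis using 0 g by (simp add: pos_divide_le_eq)
  qed
  have lip: "F' w h v - F' c h v \<le> l * ?P (w - c) * (?P h * ?Q v)"
    if w: "w \<in> fe_ball \<Omega> p V c (ereal R)" "w \<noteq> c" and hv: "h \<in> V" "v \<in> V" for w h v
  proof (cases "?P h * ?Q v = 0")
    case True
    have "w \<in> V" using w by (simp add: fe_ball_def)
    then show ?thesis unfolding F'zero[OF \<open>w \<in> V\<close> hv True] F'zero[OF c hv True] True by simp
  next
    case False
    then have 0: "0 < ?P h" "0 < ?Q v" using nn[of h] nn[of v] by (auto simp: less_le)
    have "w \<in> V" using w by (simp add: fe_ball_def)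
    then have wc: "0 < ?P (w - c)" using w(2) by (intro Ppos diff c) auto
    have nz: "h \<in> V - {0}" "v \<in> V - {0}" using hv False P0 by auto
    let ?T = "\<lambda>h v. F' w h v - F' c h v"
    have "op_norm \<Omega> p q V ?T / ereal (?P (w - c)) \<le> L"
      unfolding L_def lipschitz_const_def using w by (intro SUP_upper) simp
    then have "op_norm \<Omega> p q V ?T \<le> ereal (?P (w - c)) * L"
      using wc by (subst (asm) ereal_divide_le_pos) auto
    moreover have "dual_norm \<Omega> q V (?T h) / ereal (?P h) \<le> op_norm \<Omega> p q V ?T"
      unfolding op_norm_def using nz(1) by (rule SUP_upper)
    ultimately have "dual_norm \<Omega> q V (?T h) / ereal (?P h) \<le> ereal (?P (w - c)) * L"
      by (rule order_trans[rotated])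
    then have "dual_norm \<Omega> q V (?T h) \<le> ereal (?P h) * (ereal (?P (w - c)) * L)"
      using 0 by (subst (asm) ereal_divide_le_pos) auto
    moreover have "ereal (?T h v / ?Q v) \<le> dual_norm \<Omega> q V (?T h)"
      unfolding dual_norm_def using nz(2) by (rule SUP_upper)
    ultimately have "ereal (?T h v / ?Q v) \<le> ereal (?P h) * (ereal (?P (w - c)) * L)"
      by (rule order_trans[rotated])
    then have "?T h v / ?Q v \<le> ?P h * (?P (w - c) * l)" using l by simp
    then show ?thesis using 0 by (simp add: pos_divide_le_eq mult_ac)
  qed
  have uV: "u \<in> V" using u(1) by (simp add: fe_ball_def)
  define e where "e = u - c"
  have e: "e \<in> V" unfolding e_def using uV c by (rule diff)
  have e_small: "l * ?P e \<le> b"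
    using u(1) l b by (simp add: fe_ball_def e_def pos_le_divide_eq mult.commute)
  have R': "?P e \<le> R"
  proof -
    have "b / l \<le> R" using R l b by simp
    moreover have "?P e \<le> b / l" using e_small l by (simp add: pos_le_divide_eq mult.commute)
    ultimately show ?thesis by simp
  qed
  have line: "(\<lambda>z. c z + t * e z) \<in> V" for t using V(3)[OF c e, of 1 t] by simp
  have residual: "F c v \<le> 2 * (g * ?P e) * ?Q v" if v: "v \<in> V" for v
  proof (cases "e = 0")
    case True
    then have "u = c" by (simp add: e_def)
    then show ?thesis using u(2)[OF v] nn g b by simp
  next
    case False
    obtain t where t: "0 < t" "t < 1" "F (\<lambda>z. c z + e z) v - F c v = F' (\<lambda>z. c z + t * e z) e v"
      using C1_frechet_mean_value[OF C1 \<Omega> pq(1), of c e v] line scaled[OF e] v V(1,2) by blast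
    let ?w = "\<lambda>z. c z + t * e z"
    have "(\<lambda>z. c z + e z) = u" by (simp add: e_def fun_eq_iff)
    then have "F c v = - F' ?w e v" using t(3) u(2)[OF v] by simp
    also have "\<dots> = F' ?w e (\<lambda>z. - v z)"
    proof -
      have "?w \<in> W1_zero \<Omega> p" "e \<in> W1_zero \<Omega> p" using line e V(1) by blast+
      then have "F' ?w e \<in> dual_W1_zero \<Omega> q" by (rule C1_frechet_deriv_dual[OF C1])
      then show ?thesis using v V(2) by (simp add: dual_W1_zero_minus subset_iff)
    qed
    also have "\<dots> = (F' ?w e (\<lambda>z. - v z) - F' c e (\<lambda>z. - v z)) + F' c e (\<lambda>z. - v z)" by simp
    also have "\<dots> \<le> l * ?P (?w - c) * (?P e * ?Q v) + g * (?P e * ?Q v)"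
    proof (rule add_mono)
      have wc: "?w - c = (\<lambda>z. t * e z)" by (simp add: fun_eq_iff)
      have "?P (?w - c) \<le> ?P e" unfolding wc Pscale[OF e] using t nn[of e] by (simp add: mult_left_le_one_le)
      then have ball: "?w \<in> fe_ball \<Omega> p V c (ereal R)" using line R' by (simp add: fe_ball_def)
      obtain z where "e z \<noteq> 0" using False by (auto simp: fun_eq_iff)
      then have "?w z \<noteq> c z" using t(1) by simp
      then have ne: "?w \<noteq> c" by metis
      show "F' ?w e (\<lambda>z. - v z) - F' c e (\<lambda>z. - v z) \<le> l * ?P (?w - c) * (?P e * ?Q v)"
        using lip[OF ball ne e minus[OF v]] by (simp add: Qminus[OF v])
      show "F' c e (\<lambda>z. - v z) \<le> g * (?P e * ?Q v)"
        using cont[OF e minus[OF v]] by (simp add: Qminus[OF v])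
    qed
    also have "\<dots> \<le> g * (?P e * ?Q v) + g * (?P e * ?Q v)"
    proof (intro add_right_mono mult_right_mono mult_nonneg_nonneg nn)
      have wc: "?w - c = (\<lambda>z. t * e z)" by (simp add: fun_eq_iff)
      have "?P (?w - c) \<le> ?P e" unfolding wc Pscale[OF e] using t nn[of e] by (simp add: mult_left_le_one_le)
      then have "l * ?P (?w - c) \<le> l * ?P e" using l by (intro mult_left_mono) auto
      then show "l * ?P (?w - c) \<le> g" using e_small g by simp
    qed
    finally show ?thesis by (simp add: mult_ac)
  qed
  have coef: "2 * L / \<beta>\<^sup>2 = ereal (2 * l / b\<^sup>2)"
    using l b by (simp add: numeral_eq_ereal)
  have lower: "ereal (G d / ?Q d) \<le> res" "ereal ((F c d - G d) / ?Q d) \<le> err"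
    unfolding res_def err_def dual_norm_def by (rule SUP_upper[OF d])+
  \<comment> \<open>A bound for \<open>G\<close> comes from \<open>\<tau>\<close>, which an infinite dual norm would make infinite.\<close>
  have "err + res \<noteq> \<infinity>"
  proof
    assume "err + res = \<infinity>"
    then have "2 * L / \<beta>\<^sup>2 * (err + res) = \<infinity>" unfolding coef using l b by simp
    then show False using \<tau> by simp
  qed
  then obtain rr ee where re: "res = ereal rr" "err = ereal ee"
    using lower by (cases res; cases err) auto
  have "res \<le> ereal (2 * (g * ?P e) + ee)"
    unfolding res_def dual_norm_def
  proof (rule SUP_least)
    fix v assume v: "v \<in> V - {0}"
    have "(\<lambda>z. - v z) \<noteq> 0" using v by (auto simp: fun_eq_iff)
    then have mv: "(\<lambda>z. - v z) \<in> V - {0}" using v minus by simp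
    have "ereal ((F c (\<lambda>z. - v z) - G (\<lambda>z. - v z)) / ?Q (\<lambda>z. - v z)) \<le> err"
      unfolding err_def dual_norm_def by (rule SUP_upper[OF mv])
    moreover have "F c \<in> dual_W1_zero \<Omega> q" using c V(1) by (intro C1_frechet_dual[OF C1]) blast
    ultimately have "(G v - F c v) / ?Q v \<le> ee"
      using v V(2) G Qminus re by (simp add: dual_W1_zero_minus subset_iff)
    moreover have "F c v / ?Q v \<le> 2 * (g * ?P e)"
    proof (cases "?Q v = 0")
      case False
      then show ?thesis using residual[of v] v nn[of v] by (simp add: pos_divide_le_eq less_le)
    qed (use nn g b in simp)
    ultimately have "G v / ?Q v \<le> 2 * (g * ?P e) + ee" by (simp add: diff_divide_distrib)
    then show "ereal (G v / ?Q v) \<le> ereal (2 * (g * ?P e) + ee)" by simp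
  qed
  then have rr: "rr \<le> 2 * (g * ?P e) + ee" unfolding re by simp
  have "b / l * (1 - sqrt (1 - 2 * l / b\<^sup>2 * (ee + rr))) \<le>
      4 * inverse ((1 - c_err) / (1 + c_err)) * (g / b) * ?P e"
    using c_err \<tau> b l g nn[of e] unfolding coef re
    by (intro real_estimate rr) auto
  then show ?thesis
    unfolding coef re b(1) g(1) l(1) e_def[symmetric] using b l by simp
qed

section \<open>The projected residual\<close>

text \<open>
  On the rectangle the projection is a finite sum of products of a measurable function of \<open>x\<close> and a
  measurable function of \<open>y\<close>.
\<close>

lemma emp_proj_measurable:
  assumes \<kappa>: "\<forall>n\<in>{1..k}. set_borel_measurable lborel {y0<..<y1} (\<kappa> n)"
    and \<sigma>: "\<forall>I\<in>\<II>. \<forall>j\<in>{1..kI I}. set_integrable lborel {x0<..<x1} (\<lambda>x. \<sigma> I j (\<lambda>y. g (x, y)))"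
  shows "set_borel_measurable lborel ({x0<..<x1} \<times> {y0<..<y1})
    (emp_proj \<omega> k \<kappa> \<II> kI \<sigma> \<theta> g)"
proof -
  define a where "a I j x = indicator {x0<..<x1} x * \<sigma> I j (\<lambda>y. g (x, y))" for I j x
  define b where "b n y = indicator {y0<..<y1} y * \<kappa> n y" for n y
  have a: "a I j \<in> borel_measurable borel" if "I \<in> \<II>" "j \<in> {1..kI I}" for I j
    using borel_measurable_integrable[OF \<sigma>[rule_format, OF that, unfolded set_integrable_def]]
    by (simp add: a_def[abs_def])
  have b: "b n \<in> borel_measurable borel" if "n \<in> {1..k}" for n
    using \<kappa>[rule_format, OF that] by (simp add: b_def[abs_def] set_borel_measurable_def)
  have "(\<lambda>z. \<Sum>n=1..k. \<Sum>I\<in>\<II>. \<Sum>j=1..kI I.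
      a I j (fst z) * (LINT z:\<omega>|lborel. \<theta> I j z * \<kappa> n z) * b n (snd z)) \<in> borel_measurable (borel \<Otimes>\<^sub>M borel)"
    by (intro borel_measurable_sum borel_measurable_times borel_measurable_const
        measurable_compose[OF measurable_fst] measurable_compose[OF measurable_snd] a b)
  also have "(\<lambda>z. \<Sum>n=1..k. \<Sum>I\<in>\<II>. \<Sum>j=1..kI I.
      a I j (fst z) * (LINT z:\<omega>|lborel. \<theta> I j z * \<kappa> n z) * b n (snd z)) =
      (\<lambda>z. indicator ({x0<..<x1} \<times> {y0<..<y1}) z *\<^sub>R emp_proj \<omega> k \<kappa> \<II> kI \<sigma> \<theta> g z)"
    by (auto simp: fun_eq_iff emp_proj_def a_def b_def indicator_def)
  finally show ?thesis by (simp add: set_borel_measurable_def borel_prod)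
qed

text \<open>
  The representatives chosen for the weak derivatives of \<open>v\<close> and \<open>-v\<close> are opposite only almost
  everywhere. Measurability of \<open>u\<close> turns this into an equality of integrals, whether or not the
  integrands are integrable.
\<close>

lemma comp_pairing_minus:
  assumes \<Omega>: "open \<Omega>" and u: "\<And>i. i \<le> 2 \<Longrightarrow> set_borel_measurable lborel \<Omega> (u i)"
    and v: "v \<in> W1 \<Omega> q"
  shows "comp_pairing \<Omega> u (\<lambda>z. - v z) = - comp_pairing \<Omega> u v"
proof -
  have "(LINT z:\<Omega>|lborel. u i z * test_comp \<Omega> i (\<lambda>z. - v z) z) =
      - (LINT z:\<Omega>|lborel. u i z * test_comp \<Omega> i v z)" if i: "i \<le> 2" for i
  proof (cases "i = 0")
    case True
    then show ?thesis by (simp add: test_comp_def set_lebesgue_integral_def)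
  next
    case False
    define e :: "real \<times> real" where "e = (if i = 1 then (1, 0) else (0, 1))"
    have tc: "test_comp \<Omega> i w = weak_deriv \<Omega> e w" for w using False by (simp add: test_comp_def e_def)
    have e: "e \<in> Basis" by (simp add: e_def Basis_prod_def)
    have dv: "has_weak_deriv \<Omega> e v (weak_deriv \<Omega> e v)" by (rule W1_weak_deriv[OF \<Omega> v e])
    have dm: "has_weak_deriv \<Omega> e (\<lambda>z. - v z) (\<lambda>z. - weak_deriv \<Omega> e v z)"
      using has_weak_deriv_scale[OF dv, of "-1"] by simp
    have meas: "(\<lambda>z. indicator \<Omega> z *\<^sub>R (u i z * g z)) \<in> borel_measurable lborel"
      if "set_borel_measurable lborel \<Omega> g" for g
    proof -
      have "(\<lambda>z. (indicator \<Omega> z *\<^sub>R u i z) * (indicator \<Omega> z *\<^sub>R g z)) \<in> borel_measurable lborel"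
        using u[OF i] that unfolding set_borel_measurable_def by (rule borel_measurable_times)
      also have "(\<lambda>z. (indicator \<Omega> z *\<^sub>R u i z) * (indicator \<Omega> z *\<^sub>R g z)) = (\<lambda>z. indicator \<Omega> z *\<^sub>R (u i z * g z))"
        by (auto simp: fun_eq_iff indicator_def)
      finally show ?thesis .
    qed
    have "(LINT z:\<Omega>|lborel. u i z * weak_deriv \<Omega> e (\<lambda>z. - v z) z) =
        (LINT z:\<Omega>|lborel. u i z * (- weak_deriv \<Omega> e v z))"
      unfolding set_lebesgue_integral_def
    proof (rule integral_cong_AE)
      show "(\<lambda>z. indicator \<Omega> z *\<^sub>R (u i z * weak_deriv \<Omega> e (\<lambda>z. - v z) z)) \<in> borel_measurable lborel"
        by (rule meas[OF has_weak_deriv_measurable(2)[OF \<Omega> weak_deriv_eq(1)[OF \<Omega> dm]]])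
      show "(\<lambda>z. indicator \<Omega> z *\<^sub>R (u i z * (- weak_deriv \<Omega> e v z))) \<in> borel_measurable lborel"
        by (rule meas[OF has_weak_deriv_measurable(2)[OF \<Omega> dm]])
      show "AE z in lborel. indicator \<Omega> z *\<^sub>R (u i z * weak_deriv \<Omega> e (\<lambda>z. - v z) z) =
          indicator \<Omega> z *\<^sub>R (u i z * (- weak_deriv \<Omega> e v z))"
        using weak_deriv_eq(2)[OF \<Omega> dm] by eventually_elim (auto simp: indicator_def)
    qed
    then show ?thesis unfolding tc by (simp add: set_lebesgue_integral_def)
  qed
  then show ?thesis unfolding comp_pairing_def by (simp add: sum_negf)
qed

section \<open>Effectivity for the reduced solution\<close>

theorem proposition3p2:
  fixes p q x0 x1 y0 y1 R c_err :: real
    and N M r s m k :: nat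
    and \<xi> \<eta> :: "nat \<Rightarrow> real"
    and \<phi> \<kappa> :: "nat \<Rightarrow> real \<Rightarrow> real"
    and \<II> :: "real set set"
    and kI :: "real set \<Rightarrow> nat"
    and \<sigma> :: "real set \<Rightarrow> nat \<Rightarrow> (real \<Rightarrow> real) \<Rightarrow> real"
    and \<theta> :: "real set \<Rightarrow> nat \<Rightarrow> real \<Rightarrow> real"
    and A :: "plane_fun \<Rightarrow> nat \<Rightarrow> plane_fun"
    and f :: "plane_fun \<Rightarrow> real"
    and F' :: "plane_fun \<Rightarrow> plane_fun \<Rightarrow> plane_fun \<Rightarrow> real"
    and p_red p_fe :: plane_fun
    and \<Omega> :: "(real \<times> real) set" and \<omega> :: "real set"
    and V Vm :: "plane_fun set"
    and F PF :: "plane_fun \<Rightarrow> plane_fun \<Rightarrow> real"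
    and \<beta> \<gamma> L \<tau> err res :: ereal
    and \<Delta> C_err :: real
  defines "\<omega> \<equiv> {y0<..<y1}"
    and "\<Omega> \<equiv> {x0<..<x1} \<times> {y0<..<y1}"
    and "V \<equiv> fe_space_2d N \<xi> r M \<eta> s"
    and "Vm \<equiv> reduced_space (fe_space_1d N \<xi> r) m \<phi>"
    and "F \<equiv> residual \<Omega> A f"
    and "PF \<equiv> residual \<Omega> (\<lambda>w i. emp_proj \<omega> k \<kappa> \<II> kI \<sigma> \<theta> (A w i)) f"
    and "\<beta> \<equiv> infsup_const \<Omega> p q V (F' p_red)"
    and "\<gamma> \<equiv> continuity_const \<Omega> p q V (F' p_red)"
    and "L \<equiv> lipschitz_const \<Omega> p q V F' p_red R"
    and "err \<equiv> dual_norm \<Omega> q V (\<lambda>v. F p_red v - PF p_red v)"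
    and "res \<equiv> dual_norm \<Omega> q V (PF p_red)"
    and "\<tau> \<equiv> 2 * L / \<beta>\<^sup>2 * (err + res)"
    and "\<Delta> \<equiv> real_of_ereal (\<beta> / L) * (1 - sqrt (1 - real_of_ereal \<tau>))"
    and "C_err \<equiv> (1 - c_err) / (1 + c_err)"
  assumes exponents: "2 \<le> p" "1 / p + 1 / q = 1"
    and domain: "x0 < x1" "y0 < y1"
    and mesh: "interval_nodes x0 x1 N \<xi>" "interval_nodes y0 y1 M \<eta>"
    and reduced_basis: "\<forall>l\<in>{1..m}. \<phi> l \<in> fe_space_1d M \<eta> s" "L2_orthonormal \<omega> m \<phi>"
    and empirical: "empirical_system \<omega> k \<kappa> \<II> kI \<sigma> \<theta>"
    and A_pairing: "\<forall>w\<in>W1_zero \<Omega> p. \<forall>v\<in>W1_zero \<Omega> q. \<forall>i\<le>2.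
          set_integrable lborel \<Omega> (\<lambda>z. A w i z * test_comp \<Omega> i v z)"
    and A_projectable: "\<forall>w\<in>Vm. \<forall>i\<le>2. \<forall>I\<in>\<II>. \<forall>j\<in>{1..kI I}.
          set_integrable lborel {x0<..<x1} (\<lambda>x. \<sigma> I j (\<lambda>y. A w i (x, y)))"
    and f: "f \<in> dual_W1_zero \<Omega> q"
    and F_C1: "C1_frechet \<Omega> p q F F'"
    and p_red: "p_red \<in> Vm" "\<forall>v\<in>Vm. PF p_red v = 0"
    and \<beta>_pos: "0 < \<beta>"
    and L_bounds: "0 < L" "L < \<infinity>"
    and R: "0 < R" "\<beta> / L \<le> ereal R"
    and c_err: "0 \<le> c_err" "c_err < 1" "err \<le> ereal c_err * res"
    and \<tau>_small: "\<tau> \<le> ereal (C_err / 2)"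
    and p_fe: "p_fe \<in> fe_ball \<Omega> p V p_red (\<beta> / L)" "\<forall>v\<in>V. F p_fe v = 0"
  shows "ereal \<Delta> \<le> ereal (4 * inverse C_err) * (\<gamma> / \<beta>) * ereal (W1_seminorm \<Omega> p (p_fe - p_red))"
proof -
  have \<Omega>: "open \<Omega>" unfolding \<Omega>_def by (intro open_Times) auto
  have q: "0 < q"
  proof -
    have "1 / p \<le> 1 / 2" using exponents(1) by (intro divide_left_mono) auto
    then have "0 < 1 / q" using exponents(2) by linarith
    then show ?thesis by simp
  qed
  have p: "0 < p" using exponents(1) by simp
  have VW: "V \<subseteq> W1_zero \<Omega> p" "V \<subseteq> W1_zero \<Omega> q"
    unfolding V_def \<Omega>_def by (intro fe_space_2d_subset_W1_zero mesh p q)+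
  have VmV: "Vm \<subseteq> V"
    unfolding Vm_def V_def using reduced_basis(1) by (intro reduced_space_subset) blast
  have PF_minus: "PF p_red (\<lambda>z. - v z) = - PF p_red v" if v: "v \<in> V" for v
  proof -
    have "set_borel_measurable lborel \<Omega> (emp_proj \<omega> k \<kappa> \<II> kI \<sigma> \<theta> (A p_red i))" if "i \<le> 2" for i
      unfolding \<Omega>_def
    proof (rule emp_proj_measurable)
      show "\<forall>n\<in>{1..k}. set_borel_measurable lborel {y0<..<y1} (\<kappa> n)"
        using empirical unfolding empirical_system_def L2_orthonormal_def \<omega>_def by blast
      show "\<forall>I\<in>\<II>. \<forall>j\<in>{1..kI I}. set_integrable lborel {x0<..<x1} (\<lambda>x. \<sigma> I j (\<lambda>y. A p_red i (x, y)))"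
        using A_projectable p_red(1) that by blast
    qed
    moreover have "v \<in> W1 \<Omega> q" using v VW(2) W1_zero_subset_W1 by blast
    moreover have "f (\<lambda>z. - v z) = - f v" using v VW(2) by (intro dual_W1_zero_minus[OF f]) blast
    ultimately show ?thesis
      unfolding PF_def residual_def by (simp add: comp_pairing_minus[OF \<Omega>])
  qed
  show ?thesis
    unfolding \<Delta>_def \<tau>_def C_err_def \<beta>_def \<gamma>_def L_def err_def res_def
  proof (rule estimator_effectivity[where F = F and G = "PF p_red" and c = p_red and u = p_fe])
    show "(\<lambda>z. \<alpha> * v z + \<beta> * w z) \<in> V" if "v \<in> V" "w \<in> V" for v w and \<alpha> \<beta> :: real
      using that unfolding V_def by (rule fe_space_2d_lincomb)
    show "p_red \<in> V" using p_red(1) VmV by blast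
    show "F p_fe v = 0" if "v \<in> V" for v using p_fe(2) that by blast
  qed (fact \<Omega> p q VW F_C1 PF_minus c_err(1,2) p_fe(1)[unfolded \<beta>_def L_def] \<beta>_pos[unfolded \<beta>_def]
      L_bounds[unfolded L_def] R(2)[unfolded \<beta>_def L_def] c_err(3)[unfolded err_def res_def]
      \<tau>_small[unfolded \<tau>_def C_err_def \<beta>_def L_def err_def res_def])+
qed

end
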